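(* Let $\mathcal{X}$ and $\mathcal{Y}$ be sets, let $\mathcal{H}\subseteq\mathcal{Y}^{\mathcal{X}}$ be a hypothesis class, and let $C_{\mathcal{H}}:=\sup_{x\in\mathcal{X}}|\{h(x):h\in\mathcal{H}\}|$. The following statements are equivalent: 1. $\mathcal{H}$ is bandit online learnable. 2. $\operatorname{BL}(\mathcal{H})<\infty$. 3. $C_{\mathcal{H}}<\infty$ and $\operatorname{L}(\mathcal{H})<\infty$.
   Context: $\mathcal{X}$ is the instance space and $\mathcal{Y}$ the label space; no assumption is made on the size of $\mathcal{Y}$. Hypothesis classes are nonempty. Bandit feedback game. An (oblivious) adversary fixes a sequence $(x_1,y_1),\dots,(x_T,y_T)\in\mathcal{X}\times\mathcal{Y}$ in advance. In each round $t\in\{1,\dots,T\}$ the learner sees $x_t$, makes a (possibly randomized) prediction $\hat y_t=\mathcal{A}(x_t)\in\mathcal{Y}$ depending on the history so far, and then observes only the bit $\mathbb{1}\{\hat y_t\neq y_t\}$ (not $y_t$). The learner may know $\mathcal{H}$ and $T$. The expected regret of the algorithm $\mathcal{A}$ is $$R_{\mathcal{A}}(T,\mathcal{H}):=\sup_{(x_1,y_1),\dots,(x_T,y_T)}\Big(\mathbb{E}\Big[\sum_{t=1}^T\mathbb{1}\{\mathcal{A}(x_t)\neq y_t\}\Big]-\inf_{h\in\mathcal{H}}\sum_{t=1}^T\mathbb{1}\{h(x_t)\neq y_t\}\Big),$$ the supremum being over all sequences in $(\mathcal{X}\times\mathcal{Y})^T$. $\mathcal{H}$ is bandit online learnable if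 there is a (potentially randomized) algorithm $\mathcal{A}$, receiving only bandit feedback, such that $R_{\mathcal{A}}(T,\mathcal{H})$ is a non-decreasing sublinear function of $T$. Trees. For a set $\mathcal{M}$, an $\mathcal{X}$-valued $\mathcal{M}$-ary tree of depth $d$ is a complete rooted tree in which each internal node is labeled by an element of $\mathcal{X}$ and has one outgoing edge for each $m\in\mathcal{M}$; it is identified with functions $\mathcal{T}_t:\mathcal{M}^{t-1}\to\mathcal{X}$, $t=1,\dots,d$, where $\mathcal{T}_t(m_{<t})$, $m_{<t}=(m_1,\dots,m_{t-1})$, is the label of the node reached by following edges $m_1,\dots,m_{t-1}$ from the root. Write $m_{\le t}=(m_1,\dots,m_t)$. Littlestone dimension $\operatorname{L}(\mathcal{H})$: the maximal depth $d$ of an $\mathcal{X}$-valued $\{\pm1\}$-ary tree $\mathcal{T}$ whose edges are labeled by elements $y(\sigma_{\le t})\in\mathcal{Y}$, with the two edges out of each node having different labels, such that for every $\sigma\in\{\pm1\}^d$ there is $h_\sigma\in\mathcal{H}$ with $h_\sigma(\mathcal{T}_t(\sigma_{<t}))=y(\sigma_{\le t})$ for all $t\le d$ (and $\operatorname{L}(\mathcal{H})=\infty$ if such trees exist of arbitrarily large depth). Bandit Littlestone dimension $\operatorname{BL}(\mathcal{H})$: the maximal depth $d$ of an $\mathcal{X}$-valued $\mathcal{Y}$-ary tree $\mathcal{T}$ such that for every path $y=(y_1,\dots,y_d)\in\mathcal{Y}^d$ there is $h_y\in\mathcal{H}$ with $h_y(\mathcal{T}_t(y_{<t}))\neq y_t$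 for all $t\le d$ (and $\operatorname{BL}(\mathcal{H})=\infty$ if such trees exist of arbitrarily large depth). *)

theory Defs
  imports "HOL-Probability.Probability" "HOL-Library.Landau_Symbols" "HOL-Library.Extended_Nat"
begin

section \<open>The bandit feedback game\<close>

text \<open>
  A deterministic learner maps the past instances, each paired with the observed bit
  (\<^term>\<open>True\<close> for a wrong prediction), and the current instance to a prediction. Its own past
  predictions are determined by these data, so they are not part of the history.
\<close>

type_synonym ('x, 'y) strategy = "('x \<times> bool) list \<Rightarrow> 'x \<Rightarrow> 'y"

primrec history :: "('x, 'y) strategy \<Rightarrow> ('x \<times> 'y) list \<Rightarrow> nat \<Rightarrow> ('x \<times> bool) list" where
  "history s zs 0 = []"
| "history s zs (Suc t) =
     history s zs t @
     [(fst (zs ! t), s (history s zs t) (fst (zs ! t)) \<noteq> snd (zs ! t))]"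

text \<open>Rounds are counted from 0.\<close>

definition prediction :: "('x, 'y) strategy \<Rightarrow> ('x \<times> 'y) list \<Rightarrow> nat \<Rightarrow> 'y" where
  "prediction s zs t = s (history s zs t) (fst (zs ! t))"

text \<open>
  A randomized learner is a probability measure on deterministic ones: any source of randomness
  (of arbitrary type) can be pushed forward to such a measure. No sigma-algebra
  on the label space is fixed; all that is required is that the events of erring in a given round,
  whose probabilities make up the expected loss, are measurable.
\<close>

definition randomized_learner :: "('x, 'y) strategy measure \<Rightarrow> bool" where
  "randomized_learner A \<longleftrightarrow> prob_space A \<and>
     (\<forall>zs. \<forall>t<length zs. {s \<in> space A. prediction s zs t \<noteq> snd (zs ! t)} \<in> sets A)"

definition expected_loss :: "('x, 'y) strategy measure \<Rightarrow> ('x \<times> 'y) list \<Rightarrow> real" where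
  "expected_loss A zs =
     (\<integral>s. (\<Sum>t<length zs. of_bool (prediction s zs t \<noteq> snd (zs ! t))) \<partial>A)"

definition hypothesis_loss :: "('x \<Rightarrow> 'y) \<Rightarrow> ('x \<times> 'y) list \<Rightarrow> real" where
  "hypothesis_loss h zs = (\<Sum>t<length zs. of_bool (h (fst (zs ! t)) \<noteq> snd (zs ! t)))"

text \<open>
  Both losses lie between 0 and the length of the sequence, so for nonempty \<open>H\<close> the real-valued
  infimum and supremum below are taken over nonempty bounded sets.
\<close>

definition regret ::
    "('x, 'y) strategy measure \<Rightarrow> nat \<Rightarrow> ('x \<Rightarrow> 'y) set \<Rightarrow> real" where
  "regret A T H =
     (SUP zs\<in>{zs. length zs = T}. expected_loss A zs - (INF h\<in>H. hypothesis_loss h zs))"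

text \<open>The learner may know the horizon, hence one randomized learner \<open>A T\<close> for every \<open>T\<close>.\<close>

definition bandit_online_learnable :: "('x \<Rightarrow> 'y) set \<Rightarrow> bool" where
  "bandit_online_learnable H \<longleftrightarrow>
     (\<exists>A :: nat \<Rightarrow> ('x, 'y) strategy measure.
        (\<forall>T. randomized_learner (A T)) \<and>
        mono (\<lambda>T. regret (A T) T H) \<and>
        (\<lambda>T. regret (A T) T H) \<in> o(\<lambda>T. real T))"

section \<open>Dimensions\<close>

text \<open>
  A tree is given by the labels of its nodes, a node being the list of edges on the path leading to
  it from the root; only nodes of depth less than \<open>d\<close> matter. \<^typ>\<open>bool\<close> plays the
  role of the index set of signs. An edge of a binary tree is identified with its lower endpoint.
\<close>

definition littlestone_shatters ::
    "('x \<Rightarrow> 'y) set \<Rightarrow> nat \<Rightarrow> (bool list \<Rightarrow> 'x) \<Rightarrow> (bool list \<Rightarrow> 'y) \<Rightarrow> bool" where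
  "littlestone_shatters H d \<T> y \<longleftrightarrow>
     (\<forall>u. length u < d \<longrightarrow> y (u @ [True]) \<noteq> y (u @ [False])) \<and>
     (\<forall>\<sigma>. length \<sigma> = d \<longrightarrow>
        (\<exists>h\<in>H. \<forall>t<d. h (\<T> (take t \<sigma>)) = y (take (Suc t) \<sigma>)))"

definition littlestone_dim :: "('x \<Rightarrow> 'y) set \<Rightarrow> enat" where
  "littlestone_dim H = Sup {enat d | d. \<exists>\<T> y. littlestone_shatters H d \<T> y}"

definition bandit_shatters :: "('x \<Rightarrow> 'y) set \<Rightarrow> nat \<Rightarrow> ('y list \<Rightarrow> 'x) \<Rightarrow> bool" where
  "bandit_shatters H d \<T> \<longleftrightarrow>
     (\<forall>y. length y = d \<longrightarrow> (\<exists>h\<in>H. \<forall>t<d. h (\<T> (take t y)) \<noteq> y ! t))"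

definition bandit_littlestone_dim :: "('x \<Rightarrow> 'y) set \<Rightarrow> enat" where
  "bandit_littlestone_dim H = Sup {enat d | d. \<exists>\<T>. bandit_shatters H d \<T>}"

definition ecard :: "'a set \<Rightarrow> enat" where
  "ecard S = (if finite S then enat (card S) else \<infinity>)"

definition label_bound :: "('x \<Rightarrow> 'y) set \<Rightarrow> enat" where
  "label_bound H = (SUP x. ecard {h x | h. h \<in> H})"

end

(*
The second equivalence is combinatorial. A bandit tree can be made from many labels at one point, or
from a Littlestone tree by always descending along an edge whose label is not the predicted one.
Conversely, a learner that predicts with Littlestone's Standard Optimal Algorithm (SOA) makes a
bounded number of mistakes: a mistake replaces a version space of dimension n by at most k version
spaces of smaller dimension, so the potential "sum of (k+1)^n" drops.

Learnability fails if one of the two parameters is infinite: in a Littlestone tree an oblivious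
adversary can choose a path on which every prediction is wrong with probability at least 1/2, and
among 2T labels at one point there is one that the learner guesses within T rounds with probability
at most 1/2.

If both are finite, polynomially many (in T) experts, obtained by overriding the SOA in boundedly many
rounds, include one that agrees with any given hypothesis. The learner explores a uniformly random
label with probability gamma and otherwise follows an expert drawn by multiplicative weights, which
are driven by the unbiased estimates from the exploration rounds only. With N experts the regret is
at most (gamma + eta) T + k ln N / (gamma eta), which is O(T^(3/4)) up to logarithms. Mixing
with a bad strategy finally makes the regret monotone.
*)

theory Submission
  imports Defs "HOL-Real_Asymp.Real_Asymp"
begin

section \<open>Littlestone trees and bandit trees\<close>

definition sublabel :: "('x \<Rightarrow> 'y) set \<Rightarrow> 'x \<Rightarrow> 'y \<Rightarrow> ('x \<Rightarrow> 'y) set" where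
  "sublabel H x y = {h \<in> H. h x = y}"

definition littlestone_depth :: "('x \<Rightarrow> 'y) set \<Rightarrow> nat \<Rightarrow> bool" where
  "littlestone_depth H d \<longleftrightarrow> (\<exists>\<T> y. littlestone_shatters H d \<T> y)"

definition bandit_depth :: "('x \<Rightarrow> 'y) set \<Rightarrow> nat \<Rightarrow> bool" where
  "bandit_depth H d \<longleftrightarrow> (\<exists>\<T>. bandit_shatters H d \<T>)"

lemma littlestone_shatters_antimono:
  assumes "littlestone_shatters H e \<T> y" "d \<le> e"
  shows "littlestone_shatters H d \<T> y"
  unfolding littlestone_shatters_def
proof (intro conjI allI impI)
  fix u :: "bool list" assume "length u < d"
  then show "y (u @ [True]) \<noteq> y (u @ [False])"
    using assms unfolding littlestone_shatters_def by auto
next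
  fix \<sigma> :: "bool list" assume len: "length \<sigma> = d"
  \<comment> \<open>A short path is extended arbitrarily to a full one; the hypothesis found there
    also fits the prefix.\<close>
  have "length (\<sigma> @ replicate (e - d) True) = e" using len assms(2) by simp
  then obtain h where "h \<in> H" and h: "\<forall>t<e. h (\<T> (take t (\<sigma> @ replicate (e - d) True)))
      = y (take (Suc t) (\<sigma> @ replicate (e - d) True))"
    using assms(1) unfolding littlestone_shatters_def by metis
  have "h (\<T> (take t \<sigma>)) = y (take (Suc t) \<sigma>)" if "t < d" for t
    using h[rule_format, of t] that len assms(2) by simp
  with \<open>h \<in> H\<close> show "\<exists>h\<in>H. \<forall>t<d. h (\<T> (take t \<sigma>)) = y (take (Suc t) \<sigma>)" by blast
qed

lemma bandit_shatters_antimono: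
  assumes "bandit_shatters H e \<T>" "d \<le> e"
  shows "bandit_shatters H d \<T>"
  unfolding bandit_shatters_def
proof (intro allI impI)
  fix ys :: "'b list" assume len: "length ys = d"
  have "length (ys @ replicate (e - d) undefined) = e" using len assms(2) by simp
  then obtain h where "h \<in> H" and h: "\<forall>t<e. h (\<T> (take t (ys @ replicate (e - d) undefined)))
      \<noteq> (ys @ replicate (e - d) undefined) ! t"
    using assms(1) unfolding bandit_shatters_def by metis
  have "h (\<T> (take t ys)) \<noteq> ys ! t" if "t < d" for t
    using h[rule_format, of t] that len assms(2) by (simp add: nth_append)
  with \<open>h \<in> H\<close> show "\<exists>h\<in>H. \<forall>t<d. h (\<T> (take t ys)) \<noteq> ys ! t" by blast
qed

lemma bandit_depth_antimono: "bandit_depth H e \<Longrightarrow> d \<le> e \<Longrightarrow> bandit_depth H d"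
  unfolding bandit_depth_def using bandit_shatters_antimono by blast

lemma bandit_depth_mono: "bandit_depth G d \<Longrightarrow> G \<subseteq> H \<Longrightarrow> bandit_depth H d"
  unfolding bandit_depth_def bandit_shatters_def by blast

lemma bandit_depth_nonempty: "bandit_depth H d \<Longrightarrow> H \<noteq> {}"
  unfolding bandit_depth_def bandit_shatters_def
  by (metis Ex_list_of_length empty_iff)

text \<open>Root removal: \<open>x\<close> labels the root, and the subtree below its edge
  \<open>y\<close> serves the hypotheses that avoid \<open>y\<close> at \<open>x\<close>.\<close>

lemma bandit_depth_Suc:
  assumes "bandit_depth H (Suc d)"
  obtains x where "\<And>y. bandit_depth {h \<in> H. h x \<noteq> y} d"
proof -
  obtain \<T> where T: "bandit_shatters H (Suc d) \<T>"
    using assms unfolding bandit_depth_def by blast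
  have "bandit_depth {h \<in> H. h (\<T> []) \<noteq> y} d" for y
    unfolding bandit_depth_def bandit_shatters_def
  proof (intro exI allI impI)
    fix ys :: "'b list" assume "length ys = d"
    then have "length (y # ys) = Suc d" by simp
    then obtain h where "h \<in> H" and h: "\<forall>t<Suc d. h (\<T> (take t (y # ys))) \<noteq> (y # ys) ! t"
      using T unfolding bandit_shatters_def by metis
    have "h (\<T> []) \<noteq> y" using h[rule_format, of 0] by simp
    moreover have "h (\<T> (y # take t ys)) \<noteq> ys ! t" if "t < d" for t
      using h[rule_format, of "Suc t"] that by simp
    ultimately show "\<exists>h\<in>{h \<in> H. h (\<T> []) \<noteq> y}. \<forall>t<d. h (\<T> (y # take t ys)) \<noteq> ys ! t"
      using \<open>h \<in> H\<close> by blast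
  qed
  then show thesis using that by blast
qed

section \<open>Gluing Littlestone trees\<close>

lemma littlestone_depth_0: "littlestone_depth H 0 \<longleftrightarrow> H \<noteq> {}"
  unfolding littlestone_depth_def littlestone_shatters_def by auto

text \<open>A new root labelled \<open>x\<close>, with edges labelled \<open>a\<close> and
  \<open>b\<close>, joins the two given trees.\<close>

lemma littlestone_depth_Suc:
  assumes "littlestone_depth (sublabel H x a) d" "littlestone_depth (sublabel H x b) d" "a \<noteq> b"
  shows "littlestone_depth H (Suc d)"
proof -
  obtain T1 y1 where 1: "littlestone_shatters (sublabel H x a) d T1 y1"
    using assms(1) unfolding littlestone_depth_def by blast
  obtain T2 y2 where 2: "littlestone_shatters (sublabel H x b) d T2 y2"
    using assms(2) unfolding littlestone_depth_def by blast
  define T where "T u = (case u of [] \<Rightarrow> x | c # v \<Rightarrow> (if c then T1 v else T2 v))" for u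
  \<comment> \<open>Edges are named by their lower endpoints: singletons are the two edges out of
    the new root, and \<open>[]\<close> names none, hence its default value.\<close>
  define y where "y u = (case u of [] \<Rightarrow> undefined
      | c # v \<Rightarrow> (if v = [] then if c then a else b else if c then y1 v else y2 v))" for u
  have "littlestone_shatters H (Suc d) T y"
    unfolding littlestone_shatters_def
  proof (intro conjI allI impI)
    fix u :: "bool list" assume "length u < Suc d"
    then show "y (u @ [True]) \<noteq> y (u @ [False])"
      using 1 2 assms(3) unfolding littlestone_shatters_def y_def
      by (cases u) auto
  next
    fix \<sigma> :: "bool list" assume "length \<sigma> = Suc d"
    then obtain c v where \<sigma>: "\<sigma> = c # v" and len: "length v = d" by (cases \<sigma>) auto
    let ?G = "sublabel H x (if c then a else b)"
    have "\<exists>h\<in>?G. \<forall>t<d. h (if c then T1 (take t v) else T2 (take t v))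
        = (if c then y1 (take (Suc t) v) else y2 (take (Suc t) v))"
      using 1 2 len unfolding littlestone_shatters_def by (cases c) auto
    then obtain h where hG: "h \<in> ?G" and h: "\<And>t. t < d \<Longrightarrow> h (if c then T1 (take t v) else T2 (take t v))
        = (if c then y1 (take (Suc t) v) else y2 (take (Suc t) v))" by blast
    have "h (T (take t \<sigma>)) = y (take (Suc t) \<sigma>)" if "t < Suc d" for t
    proof (cases t)
      case 0
      then show ?thesis using hG by (simp add: T_def y_def \<sigma> sublabel_def split: if_splits)
    next
      case (Suc s)
      then have "take (Suc s) v \<noteq> []" using that len by auto
      then show ?thesis using h[of s] Suc that by (simp add: T_def y_def \<sigma>)
    qed
    moreover have "h \<in> H" using hG by (simp add: sublabel_def)
    ultimately show "\<exists>h\<in>H. \<forall>t<Suc d. h (T (take t \<sigma>)) = y (take (Suc t) \<sigma>)" by blast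
  qed
  then show ?thesis unfolding littlestone_depth_def by blast
qed

text \<open>The label \<open>y\<close> is the prediction of Littlestone's Standard Optimal Algorithm.\<close>

lemma standard_optimal_label:
  assumes "\<not> littlestone_depth H (Suc d)"
  obtains y where "\<And>z. z \<noteq> y \<Longrightarrow> \<not> littlestone_depth (sublabel H x z) d"
  using littlestone_depth_Suc assms by metis

section \<open>Bandit depth bounded through Littlestone depth and label counts\<close>

text \<open>Costs add up: the classes are removed one at a time, at \<open>m\<close> levels each.
  The assumption is quantified over \<open>U\<close> and \<open>D\<close> because both change along
  the way.\<close>

lemma bandit_depth_drop_classes:
  assumes "finite F"
    and "\<And>i U D. i \<in> F \<Longrightarrow> bandit_depth (U \<union> G i) (D + m) \<Longrightarrow> bandit_depth U D"
    and "bandit_depth (U \<union> (\<Union>i\<in>F. G i)) (D + card F * m)"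
  shows "bandit_depth U D"
  using assms
proof (induction F arbitrary: U D rule: finite_induct)
  case empty
  then show ?case by simp
next
  case (insert i F)
  \<comment> \<open>The classes in \<open>F\<close> go first, while \<open>G i\<close> counts as
    part of the remainder.\<close>
  have "bandit_depth ((U \<union> G i) \<union> (\<Union>i\<in>F. G i)) ((D + m) + card F * m)"
    using insert.prems(2) insert.hyps by (simp add: Un_assoc add.assoc)
  then have "bandit_depth (U \<union> G i) (D + m)"
  proof (rule insert.IH[rotated])
    fix j U' D' assume j: "j \<in> F" and *: "bandit_depth (U' \<union> G j) (D' + m)"
    show "bandit_depth U' D'" by (rule insert.prems(1)[OF _ *]) (simp add: j)
  qed
  then show ?case by (rule insert.prems(1)[rotated]) simp
qed

text \<open>At the root, follow the edge of the SOA label for \<open>V\<close>: the hypotheses of \<open>V\<close> that survive split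
  into at most \<open>k\<close> classes of smaller dimension, and \<open>(k + 1) ^ Suc n \<ge> 1 + k * (k + 1) ^ n\<close>.\<close>

lemma bandit_depth_drop_class:
  assumes "\<not> littlestone_depth V n"
    and "\<And>x. finite {h x | h. h \<in> V} \<and> card {h x | h. h \<in> V} \<le> k"
    and "bandit_depth (U \<union> V) (D + (k + 1) ^ n)"
  shows "bandit_depth U D"
  using assms
proof (induction n arbitrary: U V D)
  case 0
  then have "V = {}" by (simp add: littlestone_depth_0)
  then show ?case using 0(3) bandit_depth_antimono[of U "D + (k + 1) ^ 0" D] by simp
next
  case (Suc n)
  let ?m = "(k + 1) ^ n"
  have "D + k * ?m + 1 \<le> D + (k + 1) ^ Suc n" by simp
  then have "bandit_depth (U \<union> V) (Suc (D + k * ?m))"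
    using Suc.prems(3) bandit_depth_antimono by (metis Suc_eq_plus1)
  then obtain x where x: "\<And>y. bandit_depth {h \<in> U \<union> V. h x \<noteq> y} (D + k * ?m)"
    using bandit_depth_Suc by blast
  obtain y where y: "\<And>z. z \<noteq> y \<Longrightarrow> \<not> littlestone_depth (sublabel V x z) n"
    using standard_optimal_label[OF Suc.prems(1), of x] by blast
  define F where "F = {h x | h. h \<in> V} - {y}"
  have F: "finite F" "card F \<le> k"
    using Suc.prems(2)[of x] card_Diff1_le[of "{h x | h. h \<in> V}" y] le_trans
    unfolding F_def by blast+
  have "bandit_depth (U \<union> (\<Union>z\<in>F. sublabel V x z)) (D + card F * ?m)"
  proof (rule bandit_depth_antimono)
    show "bandit_depth (U \<union> (\<Union>z\<in>F. sublabel V x z)) (D + k * ?m)"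
      by (rule bandit_depth_mono[OF x[of y]]) (auto simp: F_def sublabel_def)
    show "D + card F * ?m \<le> D + k * ?m" using F by (simp add: mult_le_mono1)
  qed
  then show ?case
  proof (rule bandit_depth_drop_classes[OF F(1), rotated])
    fix z U' D' assume that: "z \<in> F" "bandit_depth (U' \<union> sublabel V x z) (D' + ?m)"
    show "bandit_depth U' D'"
    proof (rule Suc.IH[OF _ _ that(2)])
    show "\<not> littlestone_depth (sublabel V x z) n" using that(1) y by (auto simp: F_def)
    show "finite {h x' | h. h \<in> sublabel V x z} \<and> card {h x' | h. h \<in> sublabel V x z} \<le> k" for x'
    proof -
      have "{h x' | h. h \<in> sublabel V x z} \<subseteq> {h x' | h. h \<in> V}" by (auto simp: sublabel_def)
      then show ?thesis using Suc.prems(2)[of x'] by (meson card_mono finite_subset le_trans)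
    qed
    qed
  qed
qed

section \<open>Bandit trees from Littlestone trees and from many labels\<close>

lemma littlestone_depth_imp_bandit_depth:
  assumes "littlestone_depth H d"
  shows "bandit_depth H d"
proof -
  obtain T y where Ty: "littlestone_shatters H d T y"
    using assms unfolding littlestone_depth_def by blast
  \<comment> \<open>The bit is \<open>True\<close> if the label of the \<open>True\<close> edge
    differs from the prediction \<open>p\<close>; otherwise that label is \<open>p\<close>, and the
    \<open>False\<close> edge has a different one.\<close>
  define step where "step u p = u @ [y (u @ [True]) \<noteq> p]" for u p
  define br where "br = foldl step []"
  have br_snoc: "br (ps @ [p]) = step (br ps) p" for ps p by (simp add: br_def)
  have len: "length (br ps) = length ps" for ps
    by (induction ps rule: rev_induct) (simp_all add: br_snoc step_def, simp add: br_def)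
  \<comment> \<open>\<open>br\<close> commutes with prefixes, so the node reached after
    \<open>t\<close> predictions depends on these alone.\<close>
  have tk: "take t (br ps) = br (take t ps)" for t ps
  proof (induction ps rule: rev_induct)
    case Nil then show ?case by (simp add: br_def)
  next
    case (snoc p ps)
    then show ?case by (cases "t \<le> length ps") (auto simp: br_snoc step_def len)
  qed
  have "bandit_shatters H d (\<lambda>ps. T (br ps))"
    unfolding bandit_shatters_def
  proof (intro allI impI)
    fix ps :: "'b list" assume ps: "length ps = d"
    then obtain h where "h \<in> H" and h: "\<forall>t<d. h (T (take t (br ps))) = y (take (Suc t) (br ps))"
      using Ty len unfolding littlestone_shatters_def by metis
    have "h (T (br (take t ps))) \<noteq> ps ! t" if "t < d" for t
    proof -
      have "take (Suc t) ps = take t ps @ [ps ! t]" using that ps by (simp add: take_Suc_conv_app_nth)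
      then have "h (T (br (take t ps))) = y (step (br (take t ps)) (ps ! t))"
        using h that by (simp add: tk br_snoc)
      moreover have "y (br (take t ps) @ [True]) \<noteq> y (br (take t ps) @ [False])"
        using Ty that ps len unfolding littlestone_shatters_def by simp
      ultimately show ?thesis
        by (cases "y (br (take t ps) @ [True]) = ps ! t") (auto simp: step_def)
    qed
    with \<open>h \<in> H\<close> show "\<exists>h\<in>H. \<forall>t<d. h (T (br (take t ps))) \<noteq> ps ! t" by blast
  qed
  then show ?thesis unfolding bandit_depth_def by blast
qed

text \<open>All nodes carry the same instance \<open>x\<close>; a path of length \<open>d\<close>
  excludes at most \<open>d\<close> of its labels.\<close>

lemma many_labels_imp_bandit_depth:
  fixes H :: "('x \<Rightarrow> 'y) set"
  assumes "infinite {h x | h. h \<in> H} \<or> d < card {h x | h. h \<in> H}"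
  shows "bandit_depth H d"
proof -
  have "bandit_shatters H d (\<lambda>_. x)"
    unfolding bandit_shatters_def
  proof (intro allI impI)
    fix ps :: "'y list" assume "length ps = d"
    then have "card (set ps) \<le> d" using card_length by blast
    then have "\<not> {h x | h. h \<in> H} \<subseteq> set ps"
      using assms by (meson List.finite_set card_mono finite_subset le_trans not_less)
    then obtain h where "h \<in> H" "h x \<notin> set ps" by blast
    then show "\<exists>h\<in>H. \<forall>t<d. h x \<noteq> ps ! t" using \<open>length ps = d\<close> by (metis nth_mem)
  qed
  then show ?thesis unfolding bandit_depth_def by blast
qed

section \<open>Finiteness of the dimensions and the combinatorial equivalence\<close>

text \<open>For a downward closed \<open>P\<close> the strict bound amounts to the failure of
  \<open>P\<close> at a single depth, the form in which both dimensions are handled below.\<close>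

lemma Sup_enat_less_top_iff: "Sup {enat d | d. P d} < \<infinity> \<longleftrightarrow> (\<exists>n. \<forall>d. P d \<longrightarrow> d < n)"
proof
  assume "Sup {enat d | d. P d} < \<infinity>"
  then obtain n where n: "Sup {enat d | d. P d} = enat n" by auto
  have "d < Suc n" if "P d" for d
    using Sup_upper[of "enat d" "{enat d | d. P d}"] that n by auto
  then show "\<exists>n. \<forall>d. P d \<longrightarrow> d < n" by blast
next
  assume "\<exists>n. \<forall>d. P d \<longrightarrow> d < n"
  then obtain n where "\<forall>d. P d \<longrightarrow> d < n" by blast
  then have "Sup {enat d | d. P d} \<le> enat n" by (intro Sup_least) (auto intro: less_imp_le)
  then show "Sup {enat d | d. P d} < \<infinity>" by (rule le_less_trans) simp
qed

lemma littlestone_dim_finite_iff: "littlestone_dim H < \<infinity> \<longleftrightarrow> (\<exists>n. \<not> littlestone_depth H n)"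
proof -
  have "littlestone_depth H d" if "littlestone_depth H e" "d \<le> e" for d e
    using that littlestone_shatters_antimono unfolding littlestone_depth_def by blast
  then show ?thesis
    unfolding littlestone_dim_def littlestone_depth_def[symmetric] Sup_enat_less_top_iff
    by (meson not_less order.refl)
qed

lemma bandit_littlestone_dim_finite_iff: "bandit_littlestone_dim H < \<infinity> \<longleftrightarrow> (\<exists>n. \<not> bandit_depth H n)"
  unfolding bandit_littlestone_dim_def bandit_depth_def[symmetric] Sup_enat_less_top_iff
  by (meson not_less order.refl bandit_depth_antimono)

lemma label_bound_finite_iff:
  "label_bound H < \<infinity> \<longleftrightarrow> (\<exists>k. \<forall>x. finite {h x | h. h \<in> H} \<and> card {h x | h. h \<in> H} \<le> k)"
proof
  assume "label_bound H < \<infinity>"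
  then obtain n where n: "label_bound H = enat n" by auto
  have "finite {h x | h. h \<in> H} \<and> card {h x | h. h \<in> H} \<le> n" for x
  proof -
    have "ecard {h x | h. h \<in> H} \<le> enat n"
      unfolding n[symmetric] label_bound_def by (rule SUP_upper) simp
    then show ?thesis by (simp add: ecard_def split: if_splits)
  qed
  then show "\<exists>k. \<forall>x. finite {h x | h. h \<in> H} \<and> card {h x | h. h \<in> H} \<le> k" by blast
next
  assume "\<exists>k. \<forall>x. finite {h x | h. h \<in> H} \<and> card {h x | h. h \<in> H} \<le> k"
  then obtain k where "\<forall>x. finite {h x | h. h \<in> H} \<and> card {h x | h. h \<in> H} \<le> k" by blast
  then have "label_bound H \<le> enat k"
    unfolding label_bound_def by (intro SUP_least) (simp add: ecard_def)
  then show "label_bound H < \<infinity>"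
    by (rule le_less_trans) simp
qed

lemma bandit_littlestone_dim_finite_iff_label_bound:
  "bandit_littlestone_dim H < \<infinity> \<longleftrightarrow> label_bound H < \<infinity> \<and> littlestone_dim H < \<infinity>"
proof
  assume "bandit_littlestone_dim H < \<infinity>"
  then obtain n where n: "\<not> bandit_depth H n" using bandit_littlestone_dim_finite_iff by blast
  have "finite {h x | h. h \<in> H} \<and> card {h x | h. h \<in> H} \<le> n" for x
    using n many_labels_imp_bandit_depth[of x H n] by (meson not_le)
  moreover have "\<not> littlestone_depth H n" using n littlestone_depth_imp_bandit_depth by blast
  ultimately show "label_bound H < \<infinity> \<and> littlestone_dim H < \<infinity>"
    unfolding label_bound_finite_iff littlestone_dim_finite_iff by blast
next
  assume "label_bound H < \<infinity> \<and> littlestone_dim H < \<infinity>"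
  then obtain k n where k: "\<And>x. finite {h x | h. h \<in> H} \<and> card {h x | h. h \<in> H} \<le> k"
    and n: "\<not> littlestone_depth H n"
    unfolding label_bound_finite_iff littlestone_dim_finite_iff by blast
  \<comment> \<open>With \<open>U = {}\<close> and \<open>D = 0\<close>, a tree of this depth would
    leave one of depth 0 for the empty class.\<close>
  have "\<not> bandit_depth H ((k + 1) ^ n)"
    using bandit_depth_drop_class[OF n k, of "{}" 0] bandit_depth_nonempty[of "{}" 0] by auto
  then show "bandit_littlestone_dim H < \<infinity>" using bandit_littlestone_dim_finite_iff by blast
qed

section \<open>Lower bounds on the regret\<close>

definition error_probability :: "('x, 'y) strategy measure \<Rightarrow> ('x \<times> 'y) list \<Rightarrow> nat \<Rightarrow> real" where
  "error_probability A zs t = measure A {s \<in> space A. prediction s zs t \<noteq> snd (zs ! t)}"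

lemma history_cong:
  assumes "\<And>r. r < t \<Longrightarrow> zs ! r = zs' ! r"
  shows "history s zs t = history s zs' t"
  using assms by (induction t) auto

lemma length_history [simp]: "length (history s zs t) = t"
  by (induction t) auto

text \<open>Linearity of the integral, with the loss written through indicators of the error events,
  which are measurable by assumption.\<close>

lemma expected_loss_eq_sum:
  assumes "randomized_learner A"
  shows "expected_loss A zs = (\<Sum>t<length zs. error_probability A zs t)"
proof -
  interpret prob_space A using assms by (simp add: randomized_learner_def)
  let ?E = "\<lambda>t. {s \<in> space A. prediction s zs t \<noteq> snd (zs ! t)}"
  have E: "?E t \<in> sets A" if "t < length zs" for t
    using assms that by (simp add: randomized_learner_def)
  have "expected_loss A zs = (\<integral>s. (\<Sum>t<length zs. indicator (?E t) s) \<partial>A)"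
    unfolding expected_loss_def
    by (intro Bochner_Integration.integral_cong) (auto simp: indicator_def intro!: sum.cong)
  also have "\<dots> = (\<Sum>t<length zs. (\<integral>s. indicator (?E t) s \<partial>A))"
    using E by (intro Bochner_Integration.integral_sum integrable_real_indicator) (simp_all add: less_top[symmetric])
  also have "\<dots> = (\<Sum>t<length zs. error_probability A zs t)"
    unfolding error_probability_def using E by (intro sum.cong refl) (simp add: Int_absorb1 Int_absorb2 sets.sets_into_space)
  finally show ?thesis .
qed

lemma expected_loss_bounds:
  assumes "randomized_learner A"
  shows "0 \<le> expected_loss A zs" "expected_loss A zs \<le> length zs"
proof -
  interpret prob_space A using assms by (simp add: randomized_learner_def)
  show "0 \<le> expected_loss A zs"
    unfolding expected_loss_eq_sum[OF assms] error_probability_def by (intro sum_nonneg) auto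
  have "expected_loss A zs \<le> (\<Sum>t<length zs. 1)"
    unfolding expected_loss_eq_sum[OF assms] error_probability_def by (intro sum_mono) simp
  then show "expected_loss A zs \<le> length zs" by simp
qed

lemma hypothesis_loss_nonneg: "0 \<le> hypothesis_loss h zs"
  unfolding hypothesis_loss_def by (intro sum_nonneg) auto

lemma bdd_below_hypothesis_loss: "bdd_below ((\<lambda>h. hypothesis_loss h zs) ` H)"
  using hypothesis_loss_nonneg by (intro bdd_belowI2)

lemma INF_hypothesis_loss_nonneg: "H \<noteq> {} \<Longrightarrow> 0 \<le> (INF h\<in>H. hypothesis_loss h zs)"
  by (intro cINF_greatest hypothesis_loss_nonneg)

lemma regret_set_nonempty: "{zs :: ('x \<times> 'y) list. length zs = T} \<noteq> {}"
  using Ex_list_of_length by auto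

text \<open>The side condition under which the real-valued supremum \<open>regret\<close> dominates
  the value of each sequence.\<close>

lemma bdd_above_regret:
  assumes "randomized_learner A" "H \<noteq> {}"
  shows "bdd_above ((\<lambda>zs. expected_loss A zs - (INF h\<in>H. hypothesis_loss h zs)) ` {zs. length zs = T})"
proof (rule bdd_aboveI2)
  fix zs :: "('a \<times> 'b) list" assume "zs \<in> {zs. length zs = T}"
  then show "expected_loss A zs - (INF h\<in>H. hypothesis_loss h zs) \<le> real T"
    using expected_loss_bounds[OF assms(1), of zs] INF_hypothesis_loss_nonneg[OF assms(2), of zs] by simp
qed

text \<open>On a sequence realized by \<open>h\<close> the infimum is at most 0, so a loss forced
  there is forced regret.\<close>

lemma expected_loss_le_regret:
  assumes "randomized_learner A" "h \<in> H" "length zs = T"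
    and "\<And>t. t < T \<Longrightarrow> h (fst (zs ! t)) = snd (zs ! t)"
  shows "expected_loss A zs \<le> regret A T H"
proof -
  have "(INF h\<in>H. hypothesis_loss h zs) \<le> hypothesis_loss h zs"
    using assms(2) bdd_below_hypothesis_loss by (intro cINF_lower)
  also have "hypothesis_loss h zs = 0"
    using assms(3,4) by (simp add: hypothesis_loss_def)
  finally have "expected_loss A zs \<le> expected_loss A zs - (INF h\<in>H. hypothesis_loss h zs)" by simp
  also have "\<dots> \<le> regret A T H"
    unfolding regret_def using assms by (intro cSUP_upper bdd_above_regret) auto
  finally show ?thesis .
qed

lemma regret_le:
  assumes "H \<noteq> {}"
    and "\<And>zs h. length zs = T \<Longrightarrow> h \<in> H \<Longrightarrow> expected_loss A zs \<le> hypothesis_loss h zs + B"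
  shows "regret A T H \<le> B"
  unfolding regret_def
proof (rule cSUP_least[OF regret_set_nonempty])
  fix zs :: "('a \<times> 'b) list" assume "zs \<in> {zs. length zs = T}"
  then have "expected_loss A zs - B \<le> (INF h\<in>H. hypothesis_loss h zs)"
    using assms by (intro cINF_greatest) (auto simp: algebra_simps)
  then show "expected_loss A zs - (INF h\<in>H. hypothesis_loss h zs) \<le> B" by simp
qed

text \<open>The constant 1/4 lies below the error rate 1/2 that the adversaries below enforce, and
  \<open>T \<ge> 1\<close> makes the resulting contradiction strict.\<close>

lemma learnable_small_regret:
  assumes "bandit_online_learnable H"
  obtains A T where "randomized_learner A" "T \<ge> 1" "regret A T H \<le> real T / 4"
proof -
  obtain A where A: "\<And>T. randomized_learner (A T)" and o: "(\<lambda>T. regret (A T) T H) \<in> o(\<lambda>T. real T)"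
    using assms unfolding bandit_online_learnable_def by blast
  have "eventually (\<lambda>T. norm (regret (A T) T H) \<le> 1/4 * norm (real T)) sequentially"
    using o by (rule landau_o.smallD) simp
  then have "eventually (\<lambda>T. T \<ge> 1 \<and> regret (A T) T H \<le> real T / 4) sequentially"
    using eventually_ge_at_top[of 1] by eventually_elim auto
  then obtain T where "T \<ge> 1" "regret (A T) T H \<le> real T / 4"
    by (auto dest!: eventually_happens)
  then show thesis using A that by blast
qed

section \<open>Oblivious adversaries that force errors\<close>

text \<open>Two labels exclude each other, so on every node some edge makes the learner err with
  probability at least one half, and an oblivious adversary can descend along these edges.\<close>

lemma littlestone_depth_expected_loss:
  assumes A: "randomized_learner A" and "littlestone_depth H T"
  obtains h zs where "h \<in> H" "length zs = T" "\<And>t. t < T \<Longrightarrow> h (fst (zs ! t)) = snd (zs ! t)"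
    "real T / 2 \<le> expected_loss A zs"
proof -
  interpret prob_space A using A by (simp add: randomized_learner_def)
  obtain \<T> y where sh: "littlestone_shatters H T \<T> y"
    using assms(2) unfolding littlestone_depth_def by blast
  define path where "path \<sigma> = map (\<lambda>t. (\<T> (take t \<sigma>), y (take (Suc t) \<sigma>))) [0..<length \<sigma>]" for \<sigma>
  have path_nth: "path \<sigma> ! t = (\<T> (take t \<sigma>), y (take (Suc t) \<sigma>))" if "t < length \<sigma>" for \<sigma> t
    using that by (simp add: path_def)
  have path_snoc: "path (\<sigma> @ [b]) = path \<sigma> @ [(\<T> \<sigma>, y (\<sigma> @ [b]))]" for \<sigma> b
    by (auto simp: path_def)
  have len: "length (path \<sigma>) = length \<sigma>" for \<sigma> by (simp add: path_def)
  \<comment> \<open>The path grows edge by edge; appending a round leaves the error probabilities of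
    the earlier rounds unchanged.\<close>
  have "\<exists>\<sigma>. length \<sigma> = n \<and> (\<forall>t<n. error_probability A (path \<sigma>) t \<ge> 1/2)" if "n \<le> T" for n
    using that
  proof (induction n)
    case 0
    then show ?case by simp
  next
    case (Suc n)
    then obtain \<sigma> where \<sigma>: "length \<sigma> = n" "\<forall>t<n. error_probability A (path \<sigma>) t \<ge> 1/2" by auto
    define E where "E b = {s \<in> space A. prediction s (path (\<sigma> @ [b])) n \<noteq> snd (path (\<sigma> @ [b]) ! n)}" for b
    have E_sets: "E b \<in> sets A" for b
      unfolding E_def using A \<sigma>(1) by (simp add: randomized_learner_def len)
    \<comment> \<open>The instance of round \<open>n\<close> is fixed before \<open>b\<close> is
      chosen, so both continuations face the same prediction, which cannot match both
      labels.\<close>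
    have pred: "prediction s (path (\<sigma> @ [b])) n = s (history s (path \<sigma>) n) (\<T> \<sigma>)" for s b
    proof -
      have "history s (path (\<sigma> @ [b])) n = history s (path \<sigma>) n"
        by (rule history_cong) (simp add: path_snoc nth_append len \<sigma>(1))
      then show ?thesis by (simp add: prediction_def path_snoc nth_append len \<sigma>(1))
    qed
    have "y (\<sigma> @ [True]) \<noteq> y (\<sigma> @ [False])"
      using sh Suc.prems \<sigma>(1) unfolding littlestone_shatters_def by auto
    then have "space A \<subseteq> E True \<union> E False"
      unfolding E_def pred by (auto simp: path_snoc nth_append len \<sigma>(1))
    then have "1 \<le> measure A (E True \<union> E False)"
      using E_sets by (metis finite_measure_mono prob_space sets.Un)
    also have "\<dots> \<le> measure A (E True) + measure A (E False)"
      using E_sets by (intro measure_Un_le)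
    finally have "measure A (E True) \<ge> 1/2 \<or> measure A (E False) \<ge> 1/2" by linarith
    then obtain b where b: "measure A (E b) \<ge> 1/2" by blast
    have "error_probability A (path (\<sigma> @ [b])) t \<ge> 1/2" if "t < Suc n" for t
    proof (cases "t = n")
      case True
      then show ?thesis using b by (simp add: error_probability_def E_def)
    next
      case False
      then have t: "t < n" using that by simp
      have "prediction s (path (\<sigma> @ [b])) t = prediction s (path \<sigma>) t" for s
        unfolding prediction_def using t
        by (subst history_cong[where zs' = "path \<sigma>"]) (auto simp: path_snoc nth_append len \<sigma>(1))
      then have "error_probability A (path (\<sigma> @ [b])) t = error_probability A (path \<sigma>) t"
        using t by (simp add: error_probability_def path_snoc nth_append len \<sigma>(1))
      then show ?thesis using \<sigma>(2) t by simp
    qed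
    then show ?case using \<sigma>(1) by (intro exI[of _ "\<sigma> @ [b]"]) auto
  qed
  then obtain \<sigma> where \<sigma>: "length \<sigma> = T" "\<And>t. t < T \<Longrightarrow> error_probability A (path \<sigma>) t \<ge> 1/2" by blast
  obtain h where "h \<in> H" and h: "\<forall>t<T. h (\<T> (take t \<sigma>)) = y (take (Suc t) \<sigma>)"
    using sh \<sigma>(1) unfolding littlestone_shatters_def by blast
  have "(\<Sum>t<T. 1/2) \<le> (\<Sum>t<T. error_probability A (path \<sigma>) t)"
    using \<sigma>(2) by (intro sum_mono) simp
  then have "real T / 2 \<le> expected_loss A (path \<sigma>)"
    by (simp add: expected_loss_eq_sum[OF A] len \<sigma>(1))
  then show thesis using that[OF \<open>h \<in> H\<close>, of "path \<sigma>"] h \<sigma>(1) by (simp add: len path_nth)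
qed

text \<open>As long as a strategy errs on a constant sequence, its predictions do not depend on the
  label of that sequence.\<close>

lemma prediction_constant_sequence:
  assumes "t < T" "prediction s (replicate T (x, y)) t = y"
  shows "y \<in> (\<lambda>t. s (replicate t (x, True)) x) ` {..<T}"
proof -
  let ?zs = "replicate T (x, y)"
  \<comment> \<open>The first correct round: up to it, every observed bit is
    \<open>True\<close>.\<close>
  define r where "r = (LEAST r. prediction s ?zs r = y)"
  have r: "prediction s ?zs r = y" unfolding r_def using assms(2) by (rule LeastI)
  have "r \<le> t" unfolding r_def using assms(2) by (rule Least_le)
  have least: "prediction s ?zs q \<noteq> y" if "q < r" for q
    using that not_less_Least unfolding r_def by blast
  have "history s ?zs q = replicate q (x, True)" if "q \<le> r" for q
    using that
  proof (induction q)
    case (Suc q)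
    then show ?case using least[of q] \<open>r \<le> t\<close> assms(1)
      by (simp add: prediction_def replicate_append_same)
  qed simp
  then have "prediction s ?zs r = s (replicate r (x, True)) x"
    using \<open>r \<le> t\<close> assms(1) by (simp add: prediction_def)
  moreover have "r \<in> {..<T}" using \<open>r \<le> t\<close> assms(1) by simp
  ultimately show ?thesis using r by (metis image_eqI)
qed

text \<open>Double counting: a deterministic strategy is ever right for at most \<open>T\<close> of
  the \<open>2 * T\<close> labels, so averaging over \<open>S\<close> yields a label that is ever
  guessed with probability at most 1/2.\<close>

lemma many_labels_expected_loss:
  assumes A: "randomized_learner A" and S: "finite S" "card S = 2 * T" "T \<ge> 1"
  obtains y where "y \<in> S" "real T / 2 \<le> expected_loss A (replicate T (x, y))"
proof -
  interpret prob_space A using A by (simp add: randomized_learner_def)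
  define err where "err y t = {s \<in> space A. prediction s (replicate T (x, y)) t \<noteq> snd (replicate T (x, y) ! t)}" for y t
  \<comment> \<open>The event of at least one correct prediction.\<close>
  define C where "C y = (\<Union>t<T. space A - err y t)" for y
  have err: "err y t \<in> sets A" if "t < T" for y t
  proof -
    have "t < length (replicate T (x, y))" using that by simp
    then show ?thesis using A unfolding randomized_learner_def err_def by blast
  qed
  have C: "C y \<in> sets A" for y unfolding C_def using err by (intro sets.finite_UN sets.Diff) auto
  have "card {y \<in> S. s \<in> C y} \<le> T" for s
  proof -
    have "{y \<in> S. s \<in> C y} \<subseteq> (\<lambda>t. s (replicate t (x, True)) x) ` {..<T}"
    proof
      fix y assume "y \<in> {y \<in> S. s \<in> C y}"
      then obtain t where "t < T" "prediction s (replicate T (x, y)) t = y"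
        by (auto simp: C_def err_def)
      then show "y \<in> (\<lambda>t. s (replicate t (x, True)) x) ` {..<T}"
        by (rule prediction_constant_sequence)
    qed
    then have "card {y \<in> S. s \<in> C y} \<le> card ((\<lambda>t. s (replicate t (x, True)) x) ` {..<T})"
      by (intro card_mono) auto
    also have "\<dots> \<le> T" by (metis card_image_le card_lessThan finite_lessThan)
    finally show ?thesis .
  qed
  then have ind: "(\<Sum>y\<in>S. indicator (C y) s) \<le> real T" for s
    using S(1) by (simp add: indicator_def of_bool_def[symmetric] sum.If_cases Int_def)
  have "(\<Sum>y\<in>S. measure A (C y)) = (\<integral>s. (\<Sum>y\<in>S. indicator (C y) s) \<partial>A)"
    using C by (subst Bochner_Integration.integral_sum)
      (auto intro!: integrable_real_indicator simp: less_top[symmetric] Int_absorb2 sets.sets_into_space)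
  also have "\<dots> \<le> (\<integral>s. real T \<partial>A)"
    using C ind by (intro integral_mono Bochner_Integration.integrable_sum) (auto intro!: integrable_real_indicator simp: less_top[symmetric])
  finally have le: "(\<Sum>y\<in>S. measure A (C y)) \<le> real T" by (simp add: prob_space)
  have "\<exists>y\<in>S. measure A (C y) \<le> 1/2"
  proof (rule ccontr)
    assume "\<not> ?thesis"
    then have "(\<Sum>y\<in>S. 1/2) < (\<Sum>y\<in>S. measure A (C y))"
      using S by (intro sum_strict_mono) auto
    then show False using le S by simp
  qed
  then obtain y where y: "y \<in> S" "measure A (C y) \<le> 1/2" by blast
  have "error_probability A (replicate T (x, y)) t \<ge> 1/2" if "t < T" for t
  proof -
    have "1 - measure A (err y t) = measure A (space A - err y t)"
      using err[OF that] by (simp add: prob_compl)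
    also have "\<dots> \<le> measure A (C y)"
      using C that by (intro finite_measure_mono) (auto simp: C_def)
    finally show ?thesis using y(2) by (simp add: error_probability_def err_def)
  qed
  then have "(\<Sum>t<T. 1/2) \<le> (\<Sum>t<T. error_probability A (replicate T (x, y)) t)"
    by (intro sum_mono) simp
  then show thesis using that[OF y(1)] by (simp add: expected_loss_eq_sum[OF A])
qed

lemma learnable_imp_finite_littlestone_dim:
  assumes "bandit_online_learnable H"
  shows "littlestone_dim H < \<infinity>"
proof -
  obtain A T where A: "randomized_learner A" "T \<ge> 1" "regret A T H \<le> real T / 4"
    using learnable_small_regret[OF assms] .
  have "\<not> littlestone_depth H T"
  proof
    assume "littlestone_depth H T"
    then obtain h zs where "h \<in> H" "length zs = T" "\<And>t. t < T \<Longrightarrow> h (fst (zs ! t)) = snd (zs ! t)"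
      and loss: "real T / 2 \<le> expected_loss A zs"
      using littlestone_depth_expected_loss[OF A(1)] by blast
    then have "expected_loss A zs \<le> regret A T H"
      by (intro expected_loss_le_regret[OF A(1)])
    with loss have "real T / 2 \<le> regret A T H" by simp
    then show False using A by simp
  qed
  then show ?thesis unfolding littlestone_dim_finite_iff by blast
qed

lemma infinite_or_large_subset:
  assumes "infinite L \<or> n \<le> card L"
  obtains S where "S \<subseteq> L" "finite S" "card S = n"
proof (cases "finite L")
  case True
  then show ?thesis using assms that obtain_subset_with_card_n[of n L] by auto
next
  case False
  then obtain S where "finite S" "card S = n" "S \<subseteq> L"
    using infinite_arbitrarily_large[of L n] by auto
  then show ?thesis using that by simp
qed

lemma learnable_imp_finite_label_bound:
  assumes "bandit_online_learnable H"
  shows "label_bound H < \<infinity>"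
proof -
  obtain A T where A: "randomized_learner A" "T \<ge> 1" "regret A T H \<le> real T / 4"
    using learnable_small_regret[OF assms] .
  have "finite {h x | h. h \<in> H} \<and> card {h x | h. h \<in> H} \<le> 2 * T" for x
  proof (rule ccontr)
    assume "\<not> ?thesis"
    then have "infinite {h x | h. h \<in> H} \<or> 2 * T \<le> card {h x | h. h \<in> H}"
      using nat_le_linear by blast
    then obtain S where S: "S \<subseteq> {h x | h. h \<in> H}" "finite S" "card S = 2 * T"
      by (rule infinite_or_large_subset)
    obtain y where y: "y \<in> S" "real T / 2 \<le> expected_loss A (replicate T (x, y))"
      using many_labels_expected_loss[OF A(1) S(2,3) A(2)] .
    then obtain h where h: "h \<in> H" "h x = y" using S(1) by blast
    have "expected_loss A (replicate T (x, y)) \<le> regret A T H"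
      using h by (intro expected_loss_le_regret[OF A(1) h(1)]) auto
    then show False using A y(2) by simp
  qed
  then show ?thesis unfolding label_bound_finite_iff by blast
qed

section \<open>Experts\<close>

text \<open>Here \<open>n\<close> is a depth that \<open>V\<close> does not reach. The prediction is
  an index rather than a label, so that it lies in the set \<open>{..<k}\<close> that the learner
  explores.\<close>

definition soa :: "('x \<Rightarrow> nat \<Rightarrow> 'y) \<Rightarrow> nat \<Rightarrow> ('x \<Rightarrow> 'y) set \<Rightarrow> nat \<Rightarrow> 'x \<Rightarrow> nat" where
  "soa lab k V n x =
     (SOME j. j < k \<and> (\<forall>z. z \<noteq> lab x j \<longrightarrow> \<not> littlestone_depth (sublabel V x z) (n - 1)))"

text \<open>If the optimal label is not among the enumerated ones, no hypothesis of \<open>V\<close>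
  takes it at \<open>x\<close>; then the condition holds for every label and any index
  serves.\<close>

lemma soa:
  assumes "\<not> littlestone_depth V n" "n > 0" "k > 0" and lab: "\<And>h. h \<in> V \<Longrightarrow> h x \<in> lab x ` {..<k}"
  shows "soa lab k V n x < k"
    and "z \<noteq> lab x (soa lab k V n x) \<Longrightarrow> \<not> littlestone_depth (sublabel V x z) (n - 1)"
proof -
  obtain m where m: "n = Suc m" using assms(2) by (cases n) auto
  obtain y where y: "\<And>z. z \<noteq> y \<Longrightarrow> \<not> littlestone_depth (sublabel V x z) m"
    using standard_optimal_label[of V m x] assms(1) m by auto
  have "\<exists>j<k. \<forall>z. z \<noteq> lab x j \<longrightarrow> \<not> littlestone_depth (sublabel V x z) (n - 1)"
  proof (cases "y \<in> lab x ` {..<k}")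
    case True
    then show ?thesis using y m by auto
  next
    case False
    then have "sublabel V x y = {}" using lab by (auto simp: sublabel_def)
    then have "\<not> littlestone_depth (sublabel V x y) m"
      by (simp add: littlestone_depth_def littlestone_shatters_def Ex_list_of_length)
    then have "\<not> littlestone_depth (sublabel V x z) (n - 1)" for z using y m by (cases "z = y") auto
    then show ?thesis using assms(3) by blast
  qed
  then have "soa lab k V n x < k \<and> (\<forall>z. z \<noteq> lab x (soa lab k V n x) \<longrightarrow> \<not> littlestone_depth (sublabel V x z) (n - 1))"
    unfolding soa_def by (rule someI_ex)
  then show "soa lab k V n x < k"
    and "z \<noteq> lab x (soa lab k V n x) \<Longrightarrow> \<not> littlestone_depth (sublabel V x z) (n - 1)" by blast+
qed

text \<open>The code of an expert has one entry for each round: at \<open>0\<close> the expert follows the Standard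
  Optimal Algorithm, at \<open>Suc j\<close> it predicts the label with index \<open>j\<close> and
  restricts the version space accordingly.\<close>

fun expert :: "('x \<Rightarrow> nat \<Rightarrow> 'y) \<Rightarrow> nat \<Rightarrow> ('x \<Rightarrow> 'y) set \<Rightarrow> nat \<Rightarrow> nat list \<Rightarrow> 'x list \<Rightarrow> 'x \<Rightarrow> nat" where
  "expert lab k V n [] xs x = 0"
| "expert lab k V n (c # cs) [] x = (case c of 0 \<Rightarrow> soa lab k V n x | Suc j \<Rightarrow> j)"
| "expert lab k V n (c # cs) (x' # xs) x = (case c of
      0 \<Rightarrow> expert lab k V n cs xs x
    | Suc j \<Rightarrow> expert lab k (sublabel V x' (lab x' j)) (n - 1) cs xs x)"

text \<open>The lists of length \<open>T\<close> with entries at most \<open>k\<close>, at most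
  \<open>n\<close> of them nonzero.\<close>

fun codes :: "nat \<Rightarrow> nat \<Rightarrow> nat \<Rightarrow> nat list set" where
  "codes k n 0 = {[]}"
| "codes k 0 (Suc T) = (#) 0 ` codes k 0 T"
| "codes k (Suc n) (Suc T) =
     (#) 0 ` codes k (Suc n) T \<union> (\<lambda>(j, cs). Suc j # cs) ` ({..<k} \<times> codes k n T)"

lemma finite_codes: "finite (codes k n T)"
  by (induction k n T rule: codes.induct) auto

lemma codes_nonempty: "codes k n T \<noteq> {}"
  by (induction k n T rule: codes.induct) auto

text \<open>Polynomial in \<open>T\<close> for fixed \<open>k\<close> and \<open>n\<close>, so the
  logarithm of the number of experts grows only logarithmically.\<close>

lemma card_codes: "card (codes k n T) \<le> (1 + k * T) ^ n"
proof (induction k n T rule: codes.induct)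
  case (1 k n)
  then show ?case by simp
next
  case (2 k T)
  then show ?case using card_image_le[OF finite_codes, of "(#) 0" k 0 T] by simp
next
  case (3 k n T)
  have "card (codes k (Suc n) (Suc T)) \<le>
      card ((#) 0 ` codes k (Suc n) T) + card ((\<lambda>(j, cs). Suc j # cs) ` ({..<k} \<times> codes k n T))"
    by (simp add: card_Un_le)
  also have "\<dots> \<le> card (codes k (Suc n) T) + card ({..<k} \<times> codes k n T)"
    by (intro add_mono card_image_le) (auto simp: finite_codes)
  also have "\<dots> \<le> (1 + k * T) ^ Suc n + k * (1 + k * T) ^ n"
    using 3 by (intro add_mono) (auto simp: card_cartesian_product)
  also have "\<dots> = (1 + k * Suc T) * (1 + k * T) ^ n" by (simp add: algebra_simps)
  also have "\<dots> \<le> (1 + k * Suc T) * (1 + k * Suc T) ^ n"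
    by (intro mult_left_mono power_mono) auto
  finally show ?case by simp
qed

text \<open>The code overrides exactly where the SOA of the current version space disagrees with
  \<open>h\<close>. Each override lowers the unreached depth \<open>n\<close> by one, and it cannot
  reach 0 because \<open>h\<close> itself survives.\<close>

lemma expert_agrees:
  assumes "\<not> littlestone_depth V n" "k > 0" "\<And>h x. h \<in> V \<Longrightarrow> h x \<in> lab x ` {..<k}" "h \<in> V"
  shows "\<exists>cs\<in>codes k n (length xs). \<forall>t<length xs.
     expert lab k V n cs (take t xs) (xs ! t) < k \<and>
     lab (xs ! t) (expert lab k V n cs (take t xs) (xs ! t)) = h (xs ! t)"
  using assms
proof (induction xs arbitrary: V n)
  case Nil
  then show ?case by simp
next
  case (Cons x xs)
  have "n \<noteq> 0" using Cons.prems(1,4) by (metis empty_iff littlestone_depth_0)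
  then obtain m where n: "n = Suc m" by (cases n) auto
  have soa_less: "soa lab k V n x < k"
    and soa_label: "\<And>z. z \<noteq> lab x (soa lab k V n x) \<Longrightarrow> \<not> littlestone_depth (sublabel V x z) (n - 1)"
    using soa[of V n k x lab] Cons.prems(1-3) n by blast+
  show ?case
  proof (cases "h x = lab x (soa lab k V n x)")
    case True
    obtain cs where cs: "cs \<in> codes k n (length xs)" "\<forall>t<length xs.
       expert lab k V n cs (take t xs) (xs ! t) < k \<and>
       lab (xs ! t) (expert lab k V n cs (take t xs) (xs ! t)) = h (xs ! t)"
      using Cons.IH[of V n] Cons.prems by blast
    show ?thesis
    proof (intro bexI[of _ "0 # cs"] allI impI)
      show "0 # cs \<in> codes k n (length (x # xs))" using cs(1) n by simp
      fix t assume "t < length (x # xs)"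
      then show "expert lab k V n (0 # cs) (take t (x # xs)) ((x # xs) ! t) < k \<and>
       lab ((x # xs) ! t) (expert lab k V n (0 # cs) (take t (x # xs)) ((x # xs) ! t)) = h ((x # xs) ! t)"
        using cs(2) True soa_less n by (cases t) auto
    qed
  next
    case False
    obtain j where j: "j < k" "h x = lab x j" using Cons.prems(3,4) by blast
    let ?V = "sublabel V x (lab x j)"
    have "\<not> littlestone_depth ?V m" using soa_label[of "lab x j"] False j n by simp
    moreover have "h' x' \<in> lab x' ` {..<k}" if "h' \<in> ?V" for h' x'
      using that Cons.prems(3) by (auto simp: sublabel_def)
    moreover have "h \<in> ?V" using j Cons.prems(4) by (simp add: sublabel_def)
    ultimately obtain cs where cs: "cs \<in> codes k m (length xs)" "\<forall>t<length xs.
       expert lab k ?V m cs (take t xs) (xs ! t) < k \<and>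
       lab (xs ! t) (expert lab k ?V m cs (take t xs) (xs ! t)) = h (xs ! t)"
      using Cons.IH[of ?V m] Cons.prems(2) by blast
    show ?thesis
    proof (intro bexI[of _ "Suc j # cs"] allI impI)
      show "Suc j # cs \<in> codes k n (length (x # xs))" using cs(1) n j by auto
      fix t assume "t < length (x # xs)"
      then show "expert lab k V n (Suc j # cs) (take t (x # xs)) ((x # xs) ! t) < k \<and>
       lab ((x # xs) ! t) (expert lab k V n (Suc j # cs) (take t (x # xs)) ((x # xs) ! t)) = h ((x # xs) ! t)"
        using cs(2) j n by (cases t) auto
    qed
  qed
qed

section \<open>Exploration and multiplicative weights\<close>

lemma expectation_pair_pmf_finite:
  fixes f :: "'a \<times> 'b \<Rightarrow> real"
  assumes "finite (set_pmf p)" "finite (set_pmf q)"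
  shows "measure_pmf.expectation (pair_pmf p q) f =
      measure_pmf.expectation p (\<lambda>x. measure_pmf.expectation q (\<lambda>y. f (x, y)))"
    and "measure_pmf.expectation (pair_pmf p q) f =
      measure_pmf.expectation q (\<lambda>y. measure_pmf.expectation p (\<lambda>x. f (x, y)))"
proof -
  let ?P = "set_pmf p" and ?Q = "set_pmf q"
  have "measure_pmf.expectation (pair_pmf p q) f = (\<Sum>z\<in>?P \<times> ?Q. pmf (pair_pmf p q) z *\<^sub>R f z)"
    using assms by (intro integral_measure_pmf) auto
  also have "\<dots> = (\<Sum>(x, y)\<in>?P \<times> ?Q. pmf p x * (pmf q y * f (x, y)))"
    by (intro sum.cong) (auto simp: pmf_pair)
  finally have 1: "measure_pmf.expectation (pair_pmf p q) f =
      (\<Sum>x\<in>?P. \<Sum>y\<in>?Q. pmf p x * (pmf q y * f (x, y)))"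
    by (simp add: sum.cartesian_product)
  also have "\<dots> = measure_pmf.expectation p (\<lambda>x. measure_pmf.expectation q (\<lambda>y. f (x, y)))"
    using assms by (simp add: integral_measure_pmf[of ?P] integral_measure_pmf[of ?Q] sum_distrib_left)
  finally show "measure_pmf.expectation (pair_pmf p q) f = \<dots>" .
  note 1
  also have "(\<Sum>x\<in>?P. \<Sum>y\<in>?Q. pmf p x * (pmf q y * f (x, y))) =
      (\<Sum>y\<in>?Q. \<Sum>x\<in>?P. pmf q y * (pmf p x * f (x, y)))"
    by (subst sum.swap) (simp add: mult.left_commute)
  also have "\<dots> = measure_pmf.expectation q (\<lambda>y. measure_pmf.expectation p (\<lambda>x. f (x, y)))"
    using assms by (simp add: integral_measure_pmf[of ?P] integral_measure_pmf[of ?Q] sum_distrib_left)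
  finally show "measure_pmf.expectation (pair_pmf p q) f = \<dots>" .
qed

text \<open>Coordinate \<open>t\<close> is independent of the others, which alone enter the second
  argument of \<open>f\<close>, so it may be averaged first. This is applied to the exploration in
  round \<open>t\<close> and the scores before it.\<close>

lemma expectation_Pi_pmf_component_indep:
  fixes f :: "'b \<Rightarrow> ('a \<Rightarrow> 'b) \<Rightarrow> real"
  assumes "finite A" "t \<in> A" "\<And>x. x \<in> A \<Longrightarrow> finite (set_pmf (p x))"
    and f: "\<And>y e z. f y (e(t := z)) = f y e"
  shows "measure_pmf.expectation (Pi_pmf A d p) (\<lambda>e. f (e t) e) =
      measure_pmf.expectation (Pi_pmf A d p) (\<lambda>e. measure_pmf.expectation (p t) (\<lambda>y. f y e))"
proof -
  let ?B = "A - {t}"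
  have A: "A = insert t ?B" using assms(2) by blast
  have P: "Pi_pmf A d p = map_pmf (\<lambda>(y, e). e(t := y)) (pair_pmf (p t) (Pi_pmf ?B d p))"
    by (subst A, rule Pi_pmf_insert) (use assms(1) in auto)
  have fin: "finite (set_pmf (p t))" "finite (set_pmf (Pi_pmf ?B d p))"
    using assms(1-3) by (auto simp: set_Pi_pmf intro!: finite_PiE_dflt)
  show ?thesis
    unfolding P by (simp add: case_prod_beta f expectation_pair_pmf_finite(2)[OF fin])
qed

lemma sum_of_bool_single:
  fixes c :: real and a k :: nat
  assumes "a < k"
  shows "(\<Sum>j<k. c * of_bool (j = a \<and> b)) = c * of_bool b"
proof -
  have "(\<Sum>j<k. c * of_bool (j = a \<and> b)) = (\<Sum>j<k. if j = a then c * of_bool b else 0)"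
    by (intro sum.cong) auto
  also have "\<dots> = c * of_bool b" using assms by (subst sum.delta) auto
  finally show ?thesis .
qed

section \<open>The distributions of exploration and of the drawn expert\<close>

text \<open>\<open>Some j\<close> explores the label with index \<open>j\<close>;
  \<open>None\<close> leaves the round to an expert.\<close>

definition exploration :: "nat \<Rightarrow> real \<Rightarrow> nat option pmf" where
  "exploration k \<gamma> =
     bernoulli_pmf \<gamma> \<bind> (\<lambda>b. if b then map_pmf Some (pmf_of_set {..<k}) else return_pmf None)"

lemma finite_set_exploration: "k > 0 \<Longrightarrow> finite (set_pmf (exploration k \<gamma>))"
  by (simp add: exploration_def lessThan_empty_iff)

lemma expectation_exploration:
  fixes f :: "nat option \<Rightarrow> real"
  assumes "k > 0" "0 \<le> \<gamma>" "\<gamma> \<le> 1"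
  shows "measure_pmf.expectation (exploration k \<gamma>) f = \<gamma> / k * (\<Sum>j<k. f (Some j)) + (1 - \<gamma>) * f None"
  unfolding exploration_def using assms
  by (subst pmf_expectation_bind[of UNIV])
    (auto simp: UNIV_bool lessThan_empty_iff integral_pmf_of_set split: if_splits)

definition weighted_pmf :: "'i set \<Rightarrow> ('i \<Rightarrow> real) \<Rightarrow> 'i pmf" where
  "weighted_pmf I w = embed_pmf (\<lambda>i. if i \<in> I then w i / sum w I else 0)"

lemma pmf_weighted_pmf:
  assumes "finite I" "I \<noteq> {}" "\<And>i. i \<in> I \<Longrightarrow> w i > 0"
  shows "pmf (weighted_pmf I w) i = (if i \<in> I then w i / sum w I else 0)"
  unfolding weighted_pmf_def
proof (rule pmf_embed_pmf)
  have pos: "sum w I > 0" using assms by (intro sum_pos) auto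
  show "0 \<le> (if i \<in> I then w i / sum w I else 0)" for i
    using pos assms(3)[of i] by (auto intro!: divide_nonneg_pos less_imp_le)
  have "(\<integral>\<^sup>+i. ennreal (if i \<in> I then w i / sum w I else 0) \<partial>count_space UNIV)
      = (\<Sum>i\<in>I. ennreal (if i \<in> I then w i / sum w I else 0))"
    using assms(1) by (intro nn_integral_count_space') auto
  also have "\<dots> = ennreal (\<Sum>i\<in>I. w i / sum w I)"
    using pos assms(3) by (subst sum_ennreal[symmetric]) (auto simp: less_imp_le)
  also have "(\<Sum>i\<in>I. w i / sum w I) = 1" using pos by (simp add: sum_divide_distrib[symmetric])
  finally show "(\<integral>\<^sup>+i. ennreal (if i \<in> I then w i / sum w I else 0) \<partial>count_space UNIV) = 1" by simp
qed

lemma set_weighted_pmf: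
  assumes "finite I" "I \<noteq> {}" "\<And>i. i \<in> I \<Longrightarrow> w i > 0"
  shows "set_pmf (weighted_pmf I w) \<subseteq> I"
  by (auto simp: set_pmf_eq pmf_weighted_pmf[OF assms] split: if_splits)

lemma expectation_weighted_pmf:
  fixes f :: "'i \<Rightarrow> real"
  assumes "finite I" "I \<noteq> {}" "\<And>i. i \<in> I \<Longrightarrow> w i > 0"
  shows "measure_pmf.expectation (weighted_pmf I w) f = (\<Sum>i\<in>I. w i / sum w I * f i)"
  using set_weighted_pmf[of I w] assms
  by (subst integral_measure_pmf[of I]) (auto simp: pmf_weighted_pmf)


section \<open>The learner\<close>

text \<open>Only the exploration rounds enter the score of an expert: it counts the rounds in which the
  learner happened to explore exactly the label advised by the expert and that label was correct.
  The estimates therefore do not depend on the choices made while exploiting.\<close>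

definition score ::
    "('i \<Rightarrow> 'x list \<Rightarrow> 'x \<Rightarrow> nat) \<Rightarrow> 'i set \<Rightarrow> (nat \<Rightarrow> nat option) \<Rightarrow> ('x \<times> bool) list \<Rightarrow> 'i \<Rightarrow> nat" where
  "score E I ex hist i = (if i \<in> I then
     (\<Sum>r<length hist. of_bool (ex r = Some (E i (map fst (take r hist)) (fst (hist ! r))) \<and> \<not> snd (hist ! r)))
     else 0)"

text \<open>Both sources of randomness are arguments: \<open>ex\<close> decides on exploration, and
  \<open>F\<close> picks an expert from the score vector.\<close>

definition explore_exploit_strategy ::
    "('x \<Rightarrow> nat \<Rightarrow> 'y) \<Rightarrow> ('i \<Rightarrow> 'x list \<Rightarrow> 'x \<Rightarrow> nat) \<Rightarrow> 'i set \<Rightarrow>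
     (nat \<Rightarrow> nat option) \<Rightarrow> (('i \<Rightarrow> nat) \<Rightarrow> 'i) \<Rightarrow> ('x, 'y) strategy" where
  "explore_exploit_strategy lab E I ex F hist x = lab x (case ex (length hist) of
      Some j \<Rightarrow> j | None \<Rightarrow> E (F (score E I ex hist)) (map fst hist) x)"

text \<open>The expert used for exploitation is drawn in advance, independently for every possible vector
  of scores; this turns the round-by-round sampling of the multiplicative weights algorithm into
  one distribution on deterministic strategies.\<close>

definition explore_exploit ::
    "('x \<Rightarrow> nat \<Rightarrow> 'y) \<Rightarrow> ('i \<Rightarrow> 'x list \<Rightarrow> 'x \<Rightarrow> nat) \<Rightarrow> 'i set \<Rightarrow> nat \<Rightarrow> nat \<Rightarrow> real \<Rightarrow> real \<Rightarrow>
     ('x, 'y) strategy pmf" where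
  "explore_exploit lab E I k T \<gamma> \<eta> =
     map_pmf (\<lambda>(ex, F). explore_exploit_strategy lab E I ex F)
       (pair_pmf (Pi_pmf {..<T} None (\<lambda>_. exploration k \<gamma>))
         (Pi_pmf (PiE_dflt I 0 (\<lambda>_. {..T})) undefined (\<lambda>G. weighted_pmf I (\<lambda>i. (1 + \<eta>) ^ G i))))"

lemma nth_history:
  "r < t \<Longrightarrow> history s zs t ! r = (fst (zs ! r), prediction s zs r \<noteq> snd (zs ! r))"
  by (induction t) (auto simp: nth_append prediction_def less_Suc_eq)

lemma take_history: "r \<le> t \<Longrightarrow> take r (history s zs t) = history s zs r"
  by (induction t) (auto simp: le_Suc_eq)

lemma map_fst_history: "t \<le> length zs \<Longrightarrow> map fst (history s zs t) = map fst (take t zs)"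
  by (induction t) (auto simp: take_Suc_conv_app_nth)

section \<open>Regret analysis on a fixed sequence\<close>

text \<open>The adversary is oblivious, so \<open>zs\<close> is fixed and only \<open>ex\<close> and
  \<open>F\<close> remain random.\<close>

locale bandit_experts =
  fixes lab :: "'x \<Rightarrow> nat \<Rightarrow> 'y" and E :: "'i \<Rightarrow> 'x list \<Rightarrow> 'x \<Rightarrow> nat" and I :: "'i set"
    and k :: nat and \<gamma> \<eta> :: real and zs :: "('x \<times> 'y) list"
  assumes fin: "finite I" and nonempty: "I \<noteq> {}" and k: "k > 0"
    and advice_less: "\<And>i xs x. E i xs x < k"
    and \<gamma>: "0 < \<gamma>" "\<gamma> \<le> 1" and \<eta>: "0 < \<eta>" "\<eta> \<le> 1"
begin

abbreviation "T \<equiv> length zs"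

declare sum_of_bool_eq [simp del] sum_of_bool_mult_eq [simp del]

definition advice :: "nat \<Rightarrow> 'i \<Rightarrow> nat" where
  "advice t i = E i (map fst (take t zs)) (fst (zs ! t))"

definition correct :: "nat \<Rightarrow> 'i \<Rightarrow> bool" where
  "correct t i \<longleftrightarrow> lab (fst (zs ! t)) (advice t i) = snd (zs ! t)"

text \<open>The scores in terms of \<open>ex\<close> and the sequence alone, free of
  \<open>F\<close>; \<open>score_history\<close> identifies them with those the learner
  computes.\<close>

definition sc :: "(nat \<Rightarrow> nat option) \<Rightarrow> nat \<Rightarrow> 'i \<Rightarrow> nat" where
  "sc ex t i = (if i \<in> I then \<Sum>r<t. of_bool (ex r = Some (advice r i) \<and> correct r i) else 0)"

definition W :: "('i \<Rightarrow> nat) \<Rightarrow> real" where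
  "W G = (\<Sum>i\<in>I. (1 + \<eta>) ^ G i)"

text \<open>The probability that an expert drawn with weights \<open>(1 + \<eta>) ^ G i\<close> is
  right in round \<open>t\<close>.\<close>

definition gain :: "('i \<Rightarrow> nat) \<Rightarrow> nat \<Rightarrow> real" where
  "gain G t = (\<Sum>i\<in>I. (1 + \<eta>) ^ G i / W G * of_bool (correct t i))"

abbreviation "P \<equiv> Pi_pmf {..<T} None (\<lambda>_. exploration k \<gamma>)"

abbreviation "Q \<equiv> Pi_pmf (PiE_dflt I 0 (\<lambda>_. {..T})) undefined (\<lambda>G. weighted_pmf I (\<lambda>i. (1 + \<eta>) ^ G i))"

lemma advice_index_less: "advice t i < k"
  by (simp add: advice_def advice_less)

lemma W_pos: "W G > 0"
  unfolding W_def using fin nonempty \<eta> by (intro sum_pos) auto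

lemma finite_P: "finite (set_pmf P)"
  using finite_set_exploration[OF k] by (auto simp: set_Pi_pmf intro!: finite_PiE_dflt)

lemma finite_score_vectors: "finite (PiE_dflt I 0 (\<lambda>_. {..T}))"
  using fin by (intro finite_PiE_dflt) auto

lemma finite_Q: "finite (set_pmf Q)"
proof -
  have "finite (set_pmf (weighted_pmf I (\<lambda>i. (1 + \<eta>) ^ G i)))" for G
    using set_weighted_pmf[OF fin nonempty] fin \<eta> by (meson add_pos_pos finite_subset zero_less_one zero_less_power)
  then show ?thesis
    using finite_score_vectors by (auto simp: set_Pi_pmf intro!: finite_PiE_dflt)
qed

lemma sc_le: "sc ex t i \<le> t"
proof -
  have "(\<Sum>r<t. of_bool (ex r = Some (advice r i) \<and> correct r i)) \<le> (\<Sum>r<t. 1 :: nat)"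
    by (intro sum_mono) simp
  then show ?thesis by (simp add: sc_def)
qed

text \<open>The value 0 outside \<open>I\<close> keeps the vectors in the finite set over which
  \<open>F\<close> is drawn in advance.\<close>

lemma sc_in: "t < T \<Longrightarrow> sc ex t \<in> PiE_dflt I 0 (\<lambda>_. {..T})"
  using le_trans[OF sc_le[of ex t] less_imp_le] by (simp add: PiE_dflt_def) (simp add: sc_def)

text \<open>Where \<open>ex r\<close> is the advised index, the learner itself predicted that label,
  so the observed bit tells whether the expert was right; all other rounds contribute 0.\<close>

lemma score_history:
  assumes "t \<le> T"
  shows "score E I ex (history (explore_exploit_strategy lab E I ex F) zs t) = sc ex t"
proof
  fix i
  let ?s = "explore_exploit_strategy lab E I ex F"
  let ?h = "history ?s zs t"
  have "(ex r = Some (E i (map fst (take r ?h)) (fst (?h ! r))) \<and> \<not> snd (?h ! r)) \<longleftrightarrow>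
      (ex r = Some (advice r i) \<and> correct r i)" if "r < t" for r
  proof -
    have "E i (map fst (take r ?h)) (fst (?h ! r)) = advice r i"
      using that assms by (simp add: advice_def take_history map_fst_history nth_history)
    moreover have "\<not> snd (?h ! r) \<longleftrightarrow> correct r i" if "ex r = Some (advice r i)"
      using that \<open>r < t\<close> by (simp add: nth_history prediction_def explore_exploit_strategy_def correct_def)
    ultimately show ?thesis by auto
  qed
  then show "score E I ex ?h i = sc ex t i"
    unfolding score_def sc_def by (auto intro!: sum.cong)
qed

text \<open>Every exploration round is charged as an error; in the others the learner errs exactly
  when the drawn expert does.\<close>

lemma error_le:
  assumes "t < T"
  shows "of_bool (prediction (explore_exploit_strategy lab E I ex F) zs t \<noteq> snd (zs ! t))
     \<le> (of_bool (ex t \<noteq> None) + (1 - of_bool (correct t (F (sc ex t)))) :: real)"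
proof (cases "ex t")
  case None
  then have "prediction (explore_exploit_strategy lab E I ex F) zs t =
      lab (fst (zs ! t)) (advice t (F (sc ex t)))"
    using assms by (simp add: prediction_def explore_exploit_strategy_def score_history
        map_fst_history advice_def)
  then show ?thesis by (simp add: correct_def)
qed simp

lemma expectation_explored:
  assumes "t < T"
  shows "measure_pmf.expectation P (\<lambda>ex. of_bool (ex t \<noteq> None)) = \<gamma>"
proof -
  have "measure_pmf.expectation P (\<lambda>ex. of_bool (ex t \<noteq> None)) =
      measure_pmf.expectation (map_pmf (\<lambda>ex. ex t) P) (\<lambda>e. of_bool (e \<noteq> None) :: real)" by simp
  also have "map_pmf (\<lambda>ex. ex t) P = exploration k \<gamma>"
    using assms by (subst Pi_pmf_component) auto
  finally show ?thesis using k \<gamma> by (simp add: expectation_exploration)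
qed

text \<open>For fixed \<open>ex\<close> only the coordinate \<open>sc ex t\<close> of
  \<open>F\<close> matters, and its marginal is the multiplicative weights distribution.\<close>

lemma expectation_exploit:
  assumes "t < T"
  shows "measure_pmf.expectation Q (\<lambda>F. of_bool (correct t (F (sc ex t)))) = gain (sc ex t) t"
proof -
  let ?w = "\<lambda>i. (1 + \<eta>) ^ sc ex t i"
  have "measure_pmf.expectation Q (\<lambda>F. of_bool (correct t (F (sc ex t))) :: real) =
      measure_pmf.expectation (map_pmf (\<lambda>F. F (sc ex t)) Q) (\<lambda>i. of_bool (correct t i))" by simp
  also have "map_pmf (\<lambda>F. F (sc ex t)) Q = weighted_pmf I ?w"
    using sc_in[OF assms] finite_score_vectors by (subst Pi_pmf_component) auto
  also have "measure_pmf.expectation \<dots> (\<lambda>i. of_bool (correct t i)) = gain (sc ex t) t"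
    using fin nonempty \<eta> by (subst expectation_weighted_pmf) (auto simp: gain_def W_def)
  finally show ?thesis .
qed

text \<open>A round hits the advised index with probability \<open>\<gamma> / k\<close>, so the
  rescaled score is an unbiased estimate of the number of correct rounds.\<close>

lemma expectation_score:
  assumes "i \<in> I" "t \<le> T"
  shows "measure_pmf.expectation P (\<lambda>ex. real (sc ex t i)) = \<gamma> / k * (\<Sum>r<t. of_bool (correct r i))"
proof -
  have "measure_pmf.expectation P (\<lambda>ex. of_bool (ex r = Some (advice r i) \<and> correct r i)) =
      \<gamma> / k * of_bool (correct r i)" if "r < t" for r
  proof -
    have "measure_pmf.expectation P (\<lambda>ex. of_bool (ex r = Some (advice r i) \<and> correct r i)) =
      measure_pmf.expectation (map_pmf (\<lambda>ex. ex r) P) (\<lambda>e. of_bool (e = Some (advice r i) \<and> correct r i) :: real)"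
      by simp
    also have "map_pmf (\<lambda>ex. ex r) P = exploration k \<gamma>"
      using that assms by (subst Pi_pmf_component) auto
    also have "measure_pmf.expectation \<dots> (\<lambda>e. of_bool (e = Some (advice r i) \<and> correct r i)) =
        \<gamma> / k * of_bool (correct r i)"
      using k \<gamma> sum_of_bool_single[OF advice_index_less, where c = 1] by (simp add: expectation_exploration)
    finally show ?thesis .
  qed
  then have "(\<Sum>r<t. measure_pmf.expectation P (\<lambda>ex. of_bool (ex r = Some (advice r i) \<and> correct r i))) =
      \<gamma> / k * (\<Sum>r<t. of_bool (correct r i))"
    by (simp add: sum_distrib_left sum_divide_distrib)
  moreover have "measure_pmf.expectation P (\<lambda>ex. real (sc ex t i)) =
      (\<Sum>r<t. measure_pmf.expectation P (\<lambda>ex. of_bool (ex r = Some (advice r i) \<and> correct r i)))"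
    using assms(1) by (simp add: sc_def Bochner_Integration.integral_sum integrable_measure_pmf_finite[OF finite_P])
  ultimately show ?thesis by simp
qed

text \<open>Scoring multiplies a weight by \<open>1 + \<eta>\<close>, so the total grows by the
  factor one plus \<open>\<eta>\<close> times the weight share of the scored experts; then
  \<open>ln (1 + z) \<le> z\<close>.\<close>

lemma ln_W_step:
  "ln (W (sc ex (Suc t))) \<le> ln (W (sc ex t)) +
     \<eta> * (\<Sum>i\<in>I. (1 + \<eta>) ^ sc ex t i / W (sc ex t) * of_bool (ex t = Some (advice t i) \<and> correct t i))"
proof -
  let ?d = "\<lambda>i. of_bool (ex t = Some (advice t i) \<and> correct t i) :: real"
  let ?m = "\<Sum>i\<in>I. (1 + \<eta>) ^ sc ex t i / W (sc ex t) * ?d i"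
  have "W (sc ex (Suc t)) = (\<Sum>i\<in>I. (1 + \<eta>) ^ sc ex t i * (1 + \<eta> * ?d i))"
    unfolding W_def by (intro sum.cong) (auto simp: sc_def)
  also have "\<dots> = W (sc ex t) + \<eta> * (\<Sum>i\<in>I. (1 + \<eta>) ^ sc ex t i * ?d i)"
    by (simp add: W_def algebra_simps sum.distrib sum_distrib_left)
  also have "(\<Sum>i\<in>I. (1 + \<eta>) ^ sc ex t i * ?d i) = W (sc ex t) * ?m"
    using W_pos[of "sc ex t"] by (simp add: sum_distrib_left)
  finally have eq: "W (sc ex (Suc t)) = W (sc ex t) * (1 + \<eta> * ?m)" by (simp add: algebra_simps)
  have "?m \<ge> 0" using W_pos[of "sc ex t"] \<eta> by (intro sum_nonneg) auto
  then have m: "\<eta> * ?m \<ge> 0" using \<eta> by simp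
  then have "ln (W (sc ex (Suc t))) = ln (W (sc ex t)) + ln (1 + \<eta> * ?m)"
    unfolding eq using W_pos[of "sc ex t"] by (intro ln_mult_pos) auto
  moreover have "ln (1 + \<eta> * ?m) \<le> \<eta> * ?m" using m by (rule ln_add_one_self_le_self)
  ultimately show ?thesis by linarith
qed

text \<open>The scores before round \<open>t\<close> ignore \<open>ex t\<close>. Averaging over
  \<open>ex t\<close> first turns the share of scored experts into \<open>\<gamma> / k\<close> times
  the share of correct ones.\<close>

lemma expectation_ln_W_step:
  assumes "t < T"
  shows "measure_pmf.expectation P (\<lambda>ex. ln (W (sc ex (Suc t)))) \<le>
     measure_pmf.expectation P (\<lambda>ex. ln (W (sc ex t))) +
       \<eta> * \<gamma> / k * measure_pmf.expectation P (\<lambda>ex. gain (sc ex t) t)"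
proof -
  let ?f = "\<lambda>e ex. ln (W (sc ex t)) +
     \<eta> * (\<Sum>i\<in>I. (1 + \<eta>) ^ sc ex t i / W (sc ex t) * of_bool (e = Some (advice t i) \<and> correct t i))"
  note int = integrable_measure_pmf_finite[OF finite_P]
  have upd: "sc (ex(t := z)) t = sc ex t" for ex z
    by (rule ext) (simp add: sc_def)
  have E: "measure_pmf.expectation (exploration k \<gamma>) (\<lambda>e. ?f e ex) =
      ln (W (sc ex t)) + \<eta> * \<gamma> / k * gain (sc ex t) t" for ex
  proof -
    \<comment> \<open>For each expert exactly one \<open>j < k\<close> equals its advice.\<close>
    have "(\<Sum>j<k. \<Sum>i\<in>I. (1 + \<eta>) ^ sc ex t i / W (sc ex t) * of_bool (j = advice t i \<and> correct t i)) = gain (sc ex t) t"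
      unfolding gain_def by (subst sum.swap) (intro sum.cong refl sum_of_bool_single advice_index_less)
    then have "(\<Sum>j<k. ?f (Some j) ex) = k * ln (W (sc ex t)) + \<eta> * gain (sc ex t) t"
      by (simp add: sum.distrib flip: sum_distrib_left)
    moreover have "?f None ex = ln (W (sc ex t))" by simp
    ultimately have "measure_pmf.expectation (exploration k \<gamma>) (\<lambda>e. ?f e ex) =
        \<gamma> / k * (k * ln (W (sc ex t)) + \<eta> * gain (sc ex t) t) + (1 - \<gamma>) * ln (W (sc ex t))"
      using k \<gamma> by (simp only: expectation_exploration less_imp_le)
    then show ?thesis using k by (simp add: field_simps)
  qed
  have "measure_pmf.expectation P (\<lambda>ex. ln (W (sc ex (Suc t)))) \<le> measure_pmf.expectation P (\<lambda>ex. ?f (ex t) ex)"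
    using ln_W_step by (intro integral_mono int) auto
  also have "\<dots> = measure_pmf.expectation P (\<lambda>ex. measure_pmf.expectation (exploration k \<gamma>) (\<lambda>e. ?f e ex))"
    using assms finite_set_exploration[OF k]
    by (intro expectation_Pi_pmf_component_indep[where f = ?f]) (auto simp: upd)
  also have "\<dots> = measure_pmf.expectation P (\<lambda>ex. ln (W (sc ex t))) +
       \<eta> * \<gamma> / k * measure_pmf.expectation P (\<lambda>ex. gain (sc ex t) t)"
    unfolding E by (simp add: int)
  finally show ?thesis .
qed

text \<open>All scores start at 0, so \<open>W\<close> starts at \<open>card I\<close>; the single
  steps then add up.\<close>

lemma expectation_ln_W_le:
  assumes "t \<le> T"
  shows "measure_pmf.expectation P (\<lambda>ex. ln (W (sc ex t))) \<le>
     ln (real (card I)) + \<eta> * \<gamma> / k * (\<Sum>r<t. measure_pmf.expectation P (\<lambda>ex. gain (sc ex r) r))"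
  using assms
proof (induction t)
  case 0
  then show ?case by (simp add: W_def sc_def)
next
  case (Suc t)
  then show ?case using expectation_ln_W_step[of t] by (simp add: algebra_simps)
qed

text \<open>The final potential is at least the logarithm of the weight of expert \<open>i\<close>,
  where \<open>ln (1 + \<eta>) \<ge> \<eta> - \<eta>\<^sup>2\<close>, and at most the accumulated
  gain; dividing by \<open>\<gamma> * \<eta> / k\<close> compares the two.\<close>

lemma gain_sum_ge:
  assumes "i \<in> I"
  shows "(\<Sum>t<T. of_bool (correct t i)) - \<eta> * real T - real k * ln (real (card I)) / (\<gamma> * \<eta>) \<le>
     (\<Sum>t<T. measure_pmf.expectation P (\<lambda>ex. gain (sc ex t) t))" (is "?M - _ - _ \<le> ?U")
proof -
  note int = integrable_measure_pmf_finite[OF finite_P]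
  have "(\<eta> - \<eta>\<^sup>2) * real (sc ex T i) \<le> ln (W (sc ex T))" for ex
  proof -
    have "(\<eta> - \<eta>\<^sup>2) * real (sc ex T i) \<le> ln (1 + \<eta>) * real (sc ex T i)"
      using \<eta> by (intro mult_right_mono ln_one_plus_pos_lower_bound) auto
    also have "\<dots> = ln ((1 + \<eta>) ^ sc ex T i)" using \<eta> by (simp add: ln_realpow)
    also have "\<dots> \<le> ln (W (sc ex T))"
      unfolding W_def using \<eta> assms fin by (intro ln_mono member_le_sum) auto
    finally show ?thesis .
  qed
  then have "measure_pmf.expectation P (\<lambda>ex. (\<eta> - \<eta>\<^sup>2) * real (sc ex T i)) \<le>
      measure_pmf.expectation P (\<lambda>ex. ln (W (sc ex T)))"
    by (intro integral_mono int)
  also have "\<dots> \<le> ln (real (card I)) + \<eta> * \<gamma> / k * ?U" by (rule expectation_ln_W_le) simp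
  finally have "(\<eta> - \<eta>\<^sup>2) * (\<gamma> / k * ?M) \<le> ln (real (card I)) + \<eta> * \<gamma> / k * ?U"
    by (simp add: expectation_score[OF assms])
  moreover have "(\<eta> - \<eta>\<^sup>2) * (\<gamma> / k * ?M) = (\<gamma> * \<eta> / k) * ((1 - \<eta>) * ?M)"
    using k by (simp add: field_simps power2_eq_square)
  moreover have "ln (real (card I)) = (\<gamma> * \<eta> / k) * (real k * ln (real (card I)) / (\<gamma> * \<eta>))"
    using \<gamma> \<eta> k by simp
  ultimately have "(\<gamma> * \<eta> / k) * ((1 - \<eta>) * ?M) \<le>
      (\<gamma> * \<eta> / k) * (real k * ln (real (card I)) / (\<gamma> * \<eta>) + ?U)"
    by (simp only: distrib_left mult.commute[of \<gamma> \<eta>])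
  then have "(1 - \<eta>) * ?M \<le> real k * ln (real (card I)) / (\<gamma> * \<eta>) + ?U"
    using \<gamma> \<eta> k by (subst (asm) mult_le_cancel_left_pos) auto
  \<comment> \<open>The factor \<open>1 - \<eta>\<close> on \<open>?M\<close> costs at most
    \<open>\<eta> * T\<close>, since \<open>?M \<le> T\<close>.\<close>
  moreover have "\<eta> * ?M \<le> \<eta> * real T"
    using \<eta> sum_mono[of "{..<T}" "\<lambda>t. of_bool (correct t i)" "\<lambda>_. 1 :: real"] by (intro mult_left_mono) auto
  ultimately show ?thesis by (simp add: algebra_simps)
qed

text \<open>Exploration contributes \<open>\<gamma> * T\<close>; the remaining excess is the loss of
  multiplicative weights against expert \<open>i\<close>. The average is taken over \<open>F\<close>
  first, for fixed \<open>ex\<close>.\<close>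

lemma expected_loss_le:
  assumes "i \<in> I"
  shows "expected_loss (explore_exploit lab E I k T \<gamma> \<eta>) zs \<le>
     (\<Sum>t<T. of_bool (\<not> correct t i)) + (\<gamma> + \<eta>) * real T + real k * ln (real (card I)) / (\<gamma> * \<eta>)"
proof -
  note intP = integrable_measure_pmf_finite[OF finite_P]
  note intQ = integrable_measure_pmf_finite[OF finite_Q]
  have fin2: "finite (set_pmf (pair_pmf P Q))" using finite_P finite_Q by simp
  let ?b = "\<lambda>t ex F. of_bool (ex t \<noteq> None) + (1 - of_bool (correct t (F (sc ex t)))) :: real"
  have "expected_loss (explore_exploit lab E I k T \<gamma> \<eta>) zs \<le>
      measure_pmf.expectation (pair_pmf P Q) (\<lambda>(ex, F). \<Sum>t<T. ?b t ex F)"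
    unfolding expected_loss_def explore_exploit_def integral_map_pmf
    by (intro integral_mono integrable_measure_pmf_finite[OF fin2]) (auto simp del: not_None_eq intro!: sum_mono error_le)
  also have "\<dots> = measure_pmf.expectation P (\<lambda>ex. measure_pmf.expectation Q (\<lambda>F. \<Sum>t<T. ?b t ex F))"
    by (simp add: expectation_pair_pmf_finite(1)[OF finite_P finite_Q])
  also have "\<dots> = measure_pmf.expectation P (\<lambda>ex. \<Sum>t<T. of_bool (ex t \<noteq> None) + (1 - gain (sc ex t) t))"
    by (simp add: Bochner_Integration.integral_sum intQ expectation_exploit)
  also have "\<dots> = (\<Sum>t<T. \<gamma> + (1 - measure_pmf.expectation P (\<lambda>ex. gain (sc ex t) t)))"
    by (simp add: Bochner_Integration.integral_sum intP expectation_explored del: not_None_eq)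
  also have "\<dots> = \<gamma> * real T + real T - (\<Sum>t<T. measure_pmf.expectation P (\<lambda>ex. gain (sc ex t) t))"
    by (simp add: sum.distrib sum_subtractf)
  also have "\<dots> \<le> \<gamma> * real T + real T - ((\<Sum>t<T. of_bool (correct t i)) - \<eta> * real T - real k * ln (real (card I)) / (\<gamma> * \<eta>))"
    using gain_sum_ge[OF assms] by simp
  also have "\<dots> = (\<Sum>t<T. of_bool (\<not> correct t i)) + (\<gamma> + \<eta>) * real T + real k * ln (real (card I)) / (\<gamma> * \<eta>)"
    by (simp add: of_bool_not_iff sum_subtractf algebra_simps)
  finally show ?thesis .
qed

end

section \<open>A learner with sublinear regret\<close>

lemma randomized_learner_measure_pmf: "randomized_learner (measure_pmf p)"
  by (simp add: randomized_learner_def measure_pmf.prob_space_axioms)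

lemma regret_le_horizon:
  assumes "randomized_learner A" "H \<noteq> {}"
  shows "regret A T H \<le> real T"
  using assms(2)
proof (rule regret_le)
  fix zs :: "('a \<times> 'b) list" and h assume "length zs = T"
  then show "expected_loss A zs \<le> hypothesis_loss h zs + real T"
    using expected_loss_bounds(2)[OF assms(1), of zs] hypothesis_loss_nonneg[of h zs] by simp
qed

text \<open>All instances get the same index set \<open>{..<k}\<close>; surplus indices at
  \<open>x\<close> may carry any label.\<close>

lemma enumerate_labels:
  assumes "H \<noteq> {}" "\<And>x. finite {h x | h. h \<in> H} \<and> card {h x | h. h \<in> H} \<le> k"
  obtains lab where "\<And>h x. h \<in> H \<Longrightarrow> h x \<in> lab x ` {..<k}"
proof -
  have "\<exists>f. {h x | h. h \<in> H} \<subseteq> f ` {..<k}" for x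
  proof -
    have fin: "finite {h x | h. h \<in> H}" and le: "card {h x | h. h \<in> H} \<le> k" using assms(2) by blast+
    obtain f where "bij_betw f {0..<card {h x | h. h \<in> H}} {h x | h. h \<in> H}"
      using ex_bij_betw_nat_finite[OF fin] by blast
    then have "{h x | h. h \<in> H} = f ` {0..<card {h x | h. h \<in> H}}" by (simp add: bij_betw_def)
    also have "\<dots> \<subseteq> f ` {..<k}" using le by (intro image_mono) auto
    finally show ?thesis by blast
  qed
  then have "\<forall>x. \<exists>f. {h x | h. h \<in> H} \<subseteq> f ` {..<k}" by blast
  from choice[OF this] obtain lab where lab: "\<forall>x. {h x | h. h \<in> H} \<subseteq> lab x ` {..<k}" ..
  show thesis
  proof (rule that)
    fix h x assume "h \<in> H"
    then have "h x \<in> {h x | h. h \<in> H}" by blast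
    then show "h x \<in> lab x ` {..<k}" using lab by (meson subsetD)
  qed
qed

text \<open>The bound \<open>(\<gamma> + \<eta>) * T + k * ln N / (\<gamma> * \<eta>)\<close> for
  both rates equal to \<open>T powr (-1/4)\<close> and \<open>N = (1 + k * T) ^ n\<close>.\<close>

definition regret_bound :: "nat \<Rightarrow> nat \<Rightarrow> nat \<Rightarrow> real" where
  "regret_bound k n T = 2 * real T powr (3/4) + real k * (real n * ln (1 + real k * real T)) * real T powr (1/2)"

lemma mono_regret_bound: "mono (regret_bound k n)"
proof
  fix S T :: nat assume "S \<le> T"
  then have 1: "real S powr a \<le> real T powr a" if "a > 0" for a
    using that by (intro powr_mono2) auto
  have "ln (1 + real k * real S) \<le> ln (1 + real k * real T)"
    using \<open>S \<le> T\<close> by (intro ln_mono add_left_mono mult_left_mono) (auto intro!: add_pos_nonneg)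
  then show "regret_bound k n S \<le> regret_bound k n T"
    unfolding regret_bound_def by (intro add_mono mult_mono 1) (auto intro!: mult_nonneg_nonneg)
qed

lemma regret_bound_sublinear: "regret_bound k n \<in> o(\<lambda>T. real T)"
proof (cases "k = 0")
  case True
  have "(\<lambda>T. 2 * real T powr (3/4)) \<in> o(\<lambda>T. real T)" by real_asymp
  then show ?thesis using True by (simp add: regret_bound_def[abs_def])
next
  case False
  then have "real k > 0" by simp
  then have "(\<lambda>T. ln (1 + real k * real T) * real T powr (1/2)) \<in> o(\<lambda>T. real T)" by real_asymp
  then have "(\<lambda>T. (real k * real n) * (ln (1 + real k * real T) * real T powr (1/2))) \<in> o(\<lambda>T. real T)"
    using False by (cases "n = 0") (simp_all only: landau_o.small.cmult_in_iff of_nat_eq_0_iff mult_eq_0_iff, simp_all)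
  moreover have "(\<lambda>T. 2 * real T powr (3/4)) \<in> o(\<lambda>T. real T)" by real_asymp
  ultimately show ?thesis
    unfolding regret_bound_def[abs_def] by (intro sum_in_smallo(1)) (simp_all add: mult_ac)
qed

text \<open>Finite support is recorded for the mixtures below, whose expected loss must split into
  two parts.\<close>

lemma exists_learner_regret_bound:
  fixes H :: "('x \<Rightarrow> 'y) set"
  assumes "H \<noteq> {}" and labels: "\<And>x. finite {h x | h. h \<in> H} \<and> card {h x | h. h \<in> H} \<le> k"
    and n: "\<not> littlestone_depth H n"
  obtains p :: "('x, 'y) strategy pmf"
  where "finite (set_pmf p)" "regret (measure_pmf p) T H \<le> regret_bound k n T"
proof (cases "T = 0")
  \<comment> \<open>For \<open>T = 0\<close> the rate \<open>\<gamma>\<close> below would be 0; here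
    any strategy serves.\<close>
  case True
  show thesis
  proof (rule that[of "return_pmf undefined"])
    show "regret (measure_pmf (return_pmf undefined)) T H \<le> regret_bound k n T"
      using regret_le_horizon[OF randomized_learner_measure_pmf assms(1), of "return_pmf undefined" T] True
      by (simp add: regret_bound_def)
  qed simp
next
  case False
  obtain lab where lab: "\<And>h x. h \<in> H \<Longrightarrow> h x \<in> lab x ` {..<k}"
    using enumerate_labels[OF assms(1) labels] by metis
  then have k: "k > 0" using assms(1) by fastforce
  \<comment> \<open>Arbitrary codes may advise indices beyond \<open>k - 1\<close>; the cut-off
    leaves the advice of the code matching \<open>h\<close> unchanged.\<close>
  define E where "E cs xs x = min (k - 1) (expert lab k H n cs xs x)" for cs xs x
  \<comment> \<open>One value for exploration and learning rate: \<open>\<gamma> * T\<close> and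
    \<open>1 / \<gamma>\<^sup>2\<close> become the sublinear powers 3/4 and 1/2 of
    \<open>T\<close>.\<close>
  define \<gamma> where "\<gamma> = real T powr (-1/4)"
  have \<gamma>: "0 < \<gamma>" "\<gamma> \<le> 1" using False powr_mono[of "-1/4" 0 "real T"] by (auto simp: \<gamma>_def)
  let ?I = "codes k n T"
  let ?p = "explore_exploit lab E ?I k T \<gamma> \<gamma>"
  have experts: "bandit_experts E ?I k \<gamma> \<gamma>"
    using k \<gamma> by unfold_locales (auto simp: finite_codes codes_nonempty E_def)
  have "expected_loss (measure_pmf ?p) zs \<le> hypothesis_loss h zs + regret_bound k n T"
    if zs: "length zs = T" and h: "h \<in> H" for zs h
  proof -
    interpret bandit_experts lab E ?I k \<gamma> \<gamma> zs using experts .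
    let ?xs = "map fst zs"
    obtain cs where cs: "cs \<in> ?I" "\<And>t. t < T \<Longrightarrow> expert lab k H n cs (take t ?xs) (?xs ! t) < k \<and>
       lab (?xs ! t) (expert lab k H n cs (take t ?xs) (?xs ! t)) = h (?xs ! t)"
      using expert_agrees[of H n k lab h ?xs] n k lab h zs by auto
    have "correct t cs \<longleftrightarrow> h (fst (zs ! t)) = snd (zs ! t)" if "t < T" for t
    proof -
      let ?e = "expert lab k H n cs (take t ?xs) (?xs ! t)"
      have "min (k - 1) ?e = ?e" using cs(2)[OF that] by auto
      then have "E cs (take t ?xs) (?xs ! t) = ?e" by (simp add: E_def)
      then show ?thesis using cs(2)[OF that] that zs by (simp add: correct_def advice_def take_map)
    qed
    then have hyp: "(\<Sum>t<T. of_bool (\<not> correct t cs)) = hypothesis_loss h zs"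
      unfolding hypothesis_loss_def using zs by (intro sum.cong) auto
    have "real (card ?I) \<le> (1 + real k * real T) ^ n"
      using card_codes[of k n T] by (metis of_nat_1 of_nat_add of_nat_le_iff of_nat_mult of_nat_power)
    then have "ln (real (card ?I)) \<le> ln ((1 + real k * real T) ^ n)"
      using finite_codes codes_nonempty by (intro ln_mono) (auto simp: card_gt_0_iff)
    also have "\<dots> = real n * ln (1 + real k * real T)"
      by (rule ln_realpow)
    finally have "real k * ln (real (card ?I)) / (\<gamma> * \<gamma>) \<le> real k * (real n * ln (1 + real k * real T)) / (\<gamma> * \<gamma>)"
      using \<gamma> by (intro divide_right_mono mult_left_mono) auto
    also have "\<dots> = real k * (real n * ln (1 + real k * real T)) * real T powr (1/2)"
      using False by (simp add: \<gamma>_def powr_minus_divide flip: powr_add)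
    finally have "real k * ln (real (card ?I)) / (\<gamma> * \<gamma>) \<le> \<dots>" .
    moreover have "(\<gamma> + \<gamma>) * real T = 2 * real T powr (3/4)"
    proof -
      have "\<gamma> * real T = real T powr (-1/4) * real T powr 1" using False by (simp add: \<gamma>_def)
      also have "\<dots> = real T powr (3/4)" by (simp only: powr_add[symmetric]) simp
      finally show ?thesis by simp
    qed
    ultimately show ?thesis
      using expected_loss_le[OF cs(1)] zs hyp by (simp add: regret_bound_def)
  qed
  then have "regret (measure_pmf ?p) T H \<le> regret_bound k n T" by (rule regret_le[OF assms(1)])
  moreover have "finite (set_pmf ?p)"
  proof -
    \<comment> \<open>The support depends on the horizon only, so any sequence of length
      \<open>T\<close> may instantiate the locale.\<close>
    obtain zs :: "('x \<times> 'y) list" where zs: "length zs = T" using Ex_list_of_length by blast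
    interpret bandit_experts lab E ?I k \<gamma> \<gamma> zs using experts .
    show ?thesis using finite_P finite_Q zs by (simp add: explore_exploit_def)
  qed
  ultimately show thesis by (rule that[rotated])
qed

section \<open>Making the regret monotone\<close>

text \<open>The regret of the learners above need not be monotone in the horizon. Mixing a
  learner with a strategy of maximal regret changes the regret continuously, so by the intermediate
  value theorem it can be raised to the value of a monotone upper bound.\<close>

definition mix_pmf :: "real \<Rightarrow> 'a pmf \<Rightarrow> 'a \<Rightarrow> 'a pmf" where
  "mix_pmf q p s = bernoulli_pmf q \<bind> (\<lambda>b. if b then return_pmf s else p)"

lemma expected_loss_mix:
  assumes "finite (set_pmf p)" "0 \<le> q" "q \<le> 1"
  shows "expected_loss (measure_pmf (mix_pmf q p s)) zs =
     q * expected_loss (measure_pmf (return_pmf s)) zs + (1 - q) * expected_loss (measure_pmf p) zs"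
  unfolding expected_loss_def mix_pmf_def using assms
  by (subst pmf_expectation_bind[of "{False, True}"]) auto

text \<open>On each sequence the expected loss is affine in \<open>q\<close> with slope at most
  \<open>T\<close> in absolute value, and the supremum inherits this Lipschitz bound.\<close>

lemma regret_mix_le:
  assumes "H \<noteq> {}" "finite (set_pmf p)" "q \<in> {0..1}" "q' \<in> {0..1}"
  shows "regret (measure_pmf (mix_pmf q p s)) T H \<le>
     regret (measure_pmf (mix_pmf q' p s)) T H + real T * \<bar>q - q'\<bar>"
proof -
  let ?e = "\<lambda>q zs. expected_loss (measure_pmf (mix_pmf q p s)) zs"
  have "?e q zs - (INF h\<in>H. hypothesis_loss h zs) \<le>
      regret (measure_pmf (mix_pmf q' p s)) T H + real T * \<bar>q - q'\<bar>" if "length zs = T" for zs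
  proof -
    let ?a = "expected_loss (measure_pmf (return_pmf s)) zs" and ?b = "expected_loss (measure_pmf p) zs"
    have "\<bar>?a - ?b\<bar> \<le> real T"
      using expected_loss_bounds[OF randomized_learner_measure_pmf, of "return_pmf s" zs]
        expected_loss_bounds[OF randomized_learner_measure_pmf, of p zs] that by linarith
    then have "\<bar>q - q'\<bar> * \<bar>?a - ?b\<bar> \<le> \<bar>q - q'\<bar> * real T"
      by (intro mult_left_mono) auto
    then have "(q - q') * (?a - ?b) \<le> \<bar>q - q'\<bar> * real T"
      by (simp only: abs_le_iff flip: abs_mult)
    moreover have "?e q zs = ?e q' zs + (q - q') * (?a - ?b)"
      using assms(2-4) by (simp add: expected_loss_mix algebra_simps)
    ultimately have "?e q zs \<le> ?e q' zs + real T * \<bar>q - q'\<bar>" by (simp add: mult.commute)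
    moreover have "?e q' zs - (INF h\<in>H. hypothesis_loss h zs) \<le> regret (measure_pmf (mix_pmf q' p s)) T H"
      unfolding regret_def using that assms(1) randomized_learner_measure_pmf
      by (intro cSUP_upper bdd_above_regret) auto
    ultimately show ?thesis by simp
  qed
  then show ?thesis
    unfolding regret_def[of "measure_pmf (mix_pmf q p s)"]
    by (intro cSUP_least[OF regret_set_nonempty]) simp
qed

lemma exists_learner_with_regret:
  fixes p :: "('x, 'y) strategy pmf"
  assumes "H \<noteq> {}" "finite (set_pmf p)"
    and "regret (measure_pmf p) T H \<le> g" "g \<le> regret (measure_pmf (return_pmf s)) T H"
  obtains p' :: "('x, 'y) strategy pmf" where "regret (measure_pmf p') T H = g"
proof -
  let ?f = "\<lambda>q. regret (measure_pmf (mix_pmf q p s)) T H"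
  have "(real T)-lipschitz_on {0..1} ?f"
  proof (rule lipschitz_onI)
    fix q q' :: real assume "q \<in> {0..1}" "q' \<in> {0..1}"
    then show "dist (?f q) (?f q') \<le> real T * dist q q'"
      using regret_mix_le[OF assms(1,2), of q q' s T] regret_mix_le[OF assms(1,2), of q' q s T]
      by (simp add: dist_real_def abs_le_iff abs_minus_commute)
  qed simp
  then have "continuous_on {0..1} ?f" by (rule lipschitz_on_continuous_on)
  moreover have "?f 0 = regret (measure_pmf p) T H" "?f 1 = regret (measure_pmf (return_pmf s)) T H"
    using assms(2) by (simp_all add: regret_def expected_loss_mix)
  ultimately obtain q where "?f q = g" using IVT'[of ?f 0 g 1] assms(3,4) by auto
  then show thesis by (rule that)
qed

text \<open>The degenerate case, in which no strategy of large regret exists to mix with.\<close>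

lemma regret_single_label:
  fixes H :: "('x \<Rightarrow> 'y) set"
  assumes "H \<noteq> {}" "\<And>a b :: 'y. a = b"
  shows "regret A T H = 0"
proof -
  have eq: "(a \<noteq> b) = False" for a b :: 'y using assms(2) by blast
  have "expected_loss A zs = 0" "hypothesis_loss h zs = 0" for zs and h :: "'x \<Rightarrow> 'y"
    unfolding expected_loss_def hypothesis_loss_def eq by simp_all
  then show ?thesis
    unfolding regret_def using assms(1) by (simp add: cSUP_const[OF regret_set_nonempty])
qed

lemma finite_dims_imp_learnable:
  fixes H :: "('x \<Rightarrow> 'y) set"
  assumes "H \<noteq> {}" "label_bound H < \<infinity>" "littlestone_dim H < \<infinity>"
  shows "bandit_online_learnable H"
proof (cases "\<forall>a b :: 'y. a = b")
  case True
  then have "regret A T H = 0" for A T using regret_single_label[OF assms(1)] by blast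
  then show ?thesis
    unfolding bandit_online_learnable_def
    by (intro exI[of _ "\<lambda>_. measure_pmf (return_pmf undefined)"])
      (auto simp: randomized_learner_measure_pmf mono_def)
next
  case False
  obtain k n where labels: "\<And>x. finite {h x | h. h \<in> H} \<and> card {h x | h. h \<in> H} \<le> k"
    and n: "\<not> littlestone_depth H n"
    using assms(2,3) unfolding label_bound_finite_iff littlestone_dim_finite_iff by blast
  obtain h where h: "h \<in> H" using assms(1) by blast
  obtain x :: 'x where True by blast
  obtain y where y: "y \<noteq> h x" using False by metis
  \<comment> \<open>Always wrong on the constant sequence \<open>(x, h x)\<close>, which
    \<open>h\<close> labels perfectly; hence its regret is at least \<open>T\<close>.\<close>
  define s :: "('x, 'y) strategy" where "s = (\<lambda>_ _. y)"
  \<comment> \<open>The minimum with \<open>T\<close> keeps the target within the reach of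
    \<open>s\<close> and preserves monotonicity and sublinearity.\<close>
  define g where "g T = min (real T) (regret_bound k n T)" for T
  have "\<exists>p :: ('x, 'y) strategy pmf. regret (measure_pmf p) T H = g T" for T
  proof -
    obtain p :: "('x, 'y) strategy pmf"
      where p: "finite (set_pmf p)" "regret (measure_pmf p) T H \<le> regret_bound k n T"
      using exists_learner_regret_bound[OF assms(1) labels n] by blast
    have "real T = expected_loss (measure_pmf (return_pmf s)) (replicate T (x, h x))"
      using y by (simp add: expected_loss_def prediction_def s_def)
    also have "\<dots> \<le> regret (measure_pmf (return_pmf s)) T H"
      using h by (intro expected_loss_le_regret[OF randomized_learner_measure_pmf h]) auto
    finally have "g T \<le> regret (measure_pmf (return_pmf s)) T H" by (simp add: g_def)
    moreover have "regret (measure_pmf p) T H \<le> g T"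
      using p(2) regret_le_horizon[OF randomized_learner_measure_pmf assms(1)] by (simp add: g_def)
    ultimately show ?thesis using exists_learner_with_regret[OF assms(1) p(1)] by metis
  qed
  then obtain p :: "nat \<Rightarrow> ('x, 'y) strategy pmf" where p: "\<And>T. regret (measure_pmf (p T)) T H = g T"
    by metis
  have "mono g"
    using mono_regret_bound[of k n] by (auto simp: mono_def g_def min_def intro: order_trans)
  moreover have "g \<in> o(\<lambda>T. real T)"
  proof (rule landau_o.big_small_trans[OF _ regret_bound_sublinear[of k n]])
    have "0 \<le> regret_bound k n T" for T by (simp add: regret_bound_def)
    then show "g \<in> O(regret_bound k n)"
      by (intro landau_o.big_mono always_eventually) (simp add: g_def)
  qed
  ultimately show ?thesis
    unfolding bandit_online_learnable_def
    by (intro exI[of _ "\<lambda>T. measure_pmf (p T)"]) (simp add: p randomized_learner_measure_pmf)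
qed

theorem theorem1:
  fixes H :: "('x \<Rightarrow> 'y) set"
  assumes "H \<noteq> {}"
  shows "(bandit_online_learnable H \<longleftrightarrow> bandit_littlestone_dim H < \<infinity>) \<and>
         (bandit_littlestone_dim H < \<infinity> \<longleftrightarrow> label_bound H < \<infinity> \<and> littlestone_dim H < \<infinity>)"
  \<comment> \<open>Learnability is linked to statement 3 in both directions, by the adversaries and
    by the learner; statement 2 enters through the combinatorial equivalence.\<close>
  using finite_dims_imp_learnable[OF assms] learnable_imp_finite_label_bound[of H]
    learnable_imp_finite_littlestone_dim[of H] bandit_littlestone_dim_finite_iff_label_bound[of H]
  by blast

end
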